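(* Let $e\ge2$ and $\ell\ge1$ be integers, $\mathbb F$ a field containing a primitive $e$-th root of unity $q$, and $\mathbf r=(r_1,\dots,r_\ell)\in\mathbb Z^\ell$; for $n\ge0$ let $\mathcal H_n=\mathcal H_{\mathbb F,q,\mathbf r}(n)$ be the Ariki-Koike algebra. Let $B$ and $C$ be blocks (of algebras $\mathcal H_n$ and $\mathcal H_{n'}$ respectively) forming a $[w:k]$-pair, with $k\ge w$. Then $B$ and $C$ are Scopes equivalent.
   Context: **Partitions, $\beta$-sets.** $\mathcal P$ is the set of all partitions, i.e. weakly decreasing infinite sequences $\lambda=(\lambda_1,\lambda_2,\dots)$ of nonnegative integers that are eventually zero; $\mathcal P^\ell$ is the set of $\ell$-partitions $\boldsymbol\lambda=(\lambda^{(1)},\dots,\lambda^{(\ell)})$; $\boldsymbol\lambda$ is an $\ell$-partition of $n$ if $\sum_j|\lambda^{(j)}|=n$. A $\beta$-set is a subset $\mathsf B\subseteq\mathbb Z$ such that $\max(\mathsf B)$ and $\min(\mathbb Z\setminus\mathsf B)$ exist; its charge is $\mathcal s(\mathsf B)=|\mathsf B\cap\mathbb Z_{\ge0}|-|\mathbb Z_{<0}\setminus\mathsf B|$. For $\lambda\in\mathcal P$, $t\in\mathbb Z$, $\beta_t(\lambda)=\{\lambda_a+t-a\mid a\in\mathbb Z^+\}$ is a $\beta$-set of charge $t$. **Weights.** For a $\beta$-set $\mathsf B$ and $0\le i\le e-1$ put $\mathsf B_i=\{a\in\mathbb Z\mid ae+i\in\mathsf B\}$ (a $\beta$-set), with elements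 $b_{i1}>b_{i2}>\cdots$; $\mathsf{wt}_e(\mathsf B)=\sum_{i=0}^{e-1}\sum_{a\ge1}(b_{ia}-\mathcal s(\mathsf B_i)+a)$ (a finite sum). For $1\le j\le\ell$ and $x=ae+b$ with $a,b\in\mathbb Z$, $0\le b<e$, let $\upsilon_j(x)=ae\ell+(\ell-j)e+b$; for $\beta$-sets $\mathsf B^{(1)},\dots,\mathsf B^{(\ell)}$ let $\mathbf U(\mathsf B^{(1)},\dots,\mathsf B^{(\ell)})=\bigcup_{j}\upsilon_j(\mathsf B^{(j)})$, a $\beta$-set. For $\boldsymbol\lambda\in\mathcal P^\ell$, $\mathbf t\in\mathbb Z^\ell$ let $\mathsf{wt}_e(\boldsymbol\lambda;\mathbf t)=\mathsf{wt}_e(\mathbf U(\beta_{t_1}(\lambda^{(1)}),\dots,\beta_{t_\ell}(\lambda^{(\ell)})))$. $\mathfrak S_\ell$ acts on the right on $\ell$-tuples by $(x_1,\dots,x_\ell)^\sigma=(x_{\sigma(1)},\dots,x_{\sigma(\ell)})$, and $\widehat{\mathbf W}_\ell=\mathbb Z^\ell\rtimes\mathfrak S_\ell$ acts on the right on $\mathcal P^\ell\times\mathbb Z^\ell$ by $(\boldsymbol\lambda;\mathbf t)^{\sigma\mathbf u}=(\boldsymbol\lambda^\sigma;\mathbf t^\sigma+e\mathbf u)$. Put $\mathsf{wt}_{\mathcal H}(\boldsymbol\lambda)=\min\{\mathsf{wt}_e(\boldsymbol\nu;\mathbf v)\mid(\boldsymbol\nu;\mathbf v)\in(\boldsymbol\lambda;\mathbf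 r)^{\widehat{\mathbf W}_\ell}\}$. **Nodes.** The Young diagram of $\boldsymbol\lambda$ is $[\boldsymbol\lambda]=\{(a,b,j)\in(\mathbb Z^+)^3\mid j\le\ell,\ b\le\lambda^{(j)}_a\}$. The $e$-residue (relative to $\mathbf r$) of $(a,b,j)$ is $b-a+r_j$ mod $e$; a node with residue $i$ is an $i$-node. If removing an $i$-node from $[\boldsymbol\lambda]$ yields $[\boldsymbol\mu]$ for some $\boldsymbol\mu\in\mathcal P^\ell$, that node is a removable $i$-node of $\boldsymbol\lambda$ and an addable $i$-node of $\boldsymbol\mu$. For $i\in\mathbb Z/e\mathbb Z$ let $\delta_i^{\mathbf r}(\boldsymbol\lambda)$ be the number of removable $i$-nodes minus the number of addable $i$-nodes of $\boldsymbol\lambda$ (equivalently $\sum_{j}\delta_i(\beta_{r_j}(\lambda^{(j)}))$, where $\delta_i(\mathsf B)=|\{x\in\mathsf B\mid x\equiv i,\ x-1\notin\mathsf B\}|-|\{x\in\mathsf B\mid x\equiv i-1,\ x+1\notin\mathsf B\}|$, congruences mod $e$). Let $\mathsf s_i\bullet_{\mathbf r}\boldsymbol\lambda$ be the $\ell$-partition obtained from $\boldsymbol\lambda$ by removing all its removable $i$-nodes and adding all its addable $i$-nodes. **Ariki-Koike algebra.** For $n\ge1$, $\mathcal H_n$ is the unital $\mathbb F$-algebra generated by $T_0,\dots,T_{n-1}$ with relations $(T_0-q^{r_1})\cdots(T_0-q^{r_\ell})=0$; $(T_a-q)(T_a+1)=0$ for $1\le a\le n-1$; $T_0T_1T_0T_1=T_1T_0T_1T_0$;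 $T_aT_{a+1}T_a=T_{a+1}T_aT_{a+1}$ for $1\le a\le n-2$; $T_aT_b=T_bT_a$ for $|a-b|\ge2$. Also $\mathcal H_0=\mathbb F$. **Specht modules and blocks** (Dipper-James-Mathas). $\mathcal H_n$ is cellular with cell modules the Specht modules $S^{\boldsymbol\lambda}$, $\boldsymbol\lambda$ an $\ell$-partition of $n$, as follows. Let $L_1=T_0$, $L_{k+1}=q^{-1}T_kL_kT_k$; $T_w=T_{i_1}\cdots T_{i_m}$ for a reduced expression $w=s_{i_1}\cdots s_{i_m}\in\mathfrak S_n$, $s_i=(i,i+1)$; $*$ the anti-automorphism of $\mathcal H_n$ fixing each $T_i$. Let $m_{\boldsymbol\lambda}=\Big(\prod_{s=2}^{\ell}\prod_{k=1}^{a_s}(L_k-q^{r_s})\Big)\sum_{w\in\mathfrak S_{\boldsymbol\lambda}}T_w$, where $a_s=|\lambda^{(1)}|+\dots+|\lambda^{(s-1)}|$ and $\mathfrak S_{\boldsymbol\lambda}$ is the row stabiliser of the tableau $\mathfrak t^{\boldsymbol\lambda}$ in which $1,\dots,n$ are entered in order along the rows of $\lambda^{(1)}$, then $\lambda^{(2)}$, etc. For a standard $\boldsymbol\lambda$-tableau $\mathfrak t$ let $d(\mathfrak t)\in\mathfrak S_n$ satisfy $\mathfrak t=\mathfrak t^{\boldsymbol\lambda}d(\mathfrak t)$ (right action on entries) and $m_{\mathfrak s\mathfrak t}=T_{d(\mathfrak s)}^*m_{\boldsymbol\lambda}T_{d(\mathfrak t)}$. Let $N^{\boldsymbol\lambda}$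 be the span of all $m_{\mathfrak s\mathfrak t}$ with $\mathfrak s,\mathfrak t$ standard of shape $\boldsymbol\mu\rhd\boldsymbol\lambda$ (strict dominance: $\boldsymbol\mu\unrhd\boldsymbol\lambda$ iff $\sum_{j<s}|\mu^{(j)}|+\sum_{a\le m}\mu^{(s)}_a\ge\sum_{j<s}|\lambda^{(j)}|+\sum_{a\le m}\lambda^{(s)}_a$ for all $s,m$), a two-sided ideal; $S^{\boldsymbol\lambda}$ is the right submodule of $\mathcal H_n/N^{\boldsymbol\lambda}$ generated by $m_{\boldsymbol\lambda}+N^{\boldsymbol\lambda}$. All composition factors of $S^{\boldsymbol\lambda}$ belong to one block; $\boldsymbol\lambda$ lies in a block $B$ of $\mathcal H_n$ iff $S^{\boldsymbol\lambda}$ does. It is known (Lyle-Mathas) that two $\ell$-partitions of $n$ lie in the same block of $\mathcal H_n$ iff, for every $i\in\mathbb Z/e\mathbb Z$, they have the same number of $i$-nodes. **$[w:k]$-pairs.** For a block $B$ of $\mathcal H_n$, the values $\mathsf{wt}_e(B):=\mathsf{wt}_{\mathcal H}(\boldsymbol\lambda)$ and $\delta_i(B):=\delta_i^{\mathbf r}(\boldsymbol\lambda)$ are the same for all $\boldsymbol\lambda$ lying in $B$. For $i\in\mathbb Z/e\mathbb Z$, $\mathsf s_i\bullet B$ denotes the block of $\mathcal H_{n-\delta_i(B)}$ in which exactly the $\ell$-partitions $\mathsf s_i\bullet_{\mathbf r}\boldsymbol\lambda$ ($\boldsymbol\lambda$ lying in $B$) lie; one has $\mathsf{wt}_e(\mathsf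 s_i\bullet B)=\mathsf{wt}_e(B)$. If $B\ne\mathsf s_i\bullet B$, the blocks $B$ and $\mathsf s_i\bullet B$ are said to form a $[w:k]$-pair, where $w=\mathsf{wt}_e(B)$ and $k=|\delta_i(B)|$. **Scopes equivalence.** $B$ and $\mathsf s_i\bullet B$ are Scopes equivalent if either all $\ell$-partitions lying in $B$ have no addable $i$-node, or all $\ell$-partitions lying in $B$ have no removable $i$-node (relative to $\mathbf r$). This is extended to an equivalence relation on all blocks by taking the reflexive and transitive closure. *)

theory Defs
  imports
    "HOL-Library.Poly_Mapping"
    "HOL-Combinatorics.Permutations"
    "HOL-Algebra.Algebra"
begin

section \<open>Partitions and beta-sets\<close>

text \<open>
  Partitions, multipartitions, charges and nodes are indexed from 1, as is usual on paper.  Sequences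
  are functions on \<^typ>\<open>nat\<close>; the unused index 0 (and, for multipartitions, every component
  outside \<open>{1..l}\<close>) carries the value 0, so that equality of functions is equality of sequences.
  A multicharge \<open>r :: nat \<Rightarrow> int\<close> is only ever evaluated on \<open>{1..l}\<close>.
\<close>

definition partitions :: "(nat \<Rightarrow> nat) set" where
  "partitions = {p. p 0 = 0 \<and> (\<forall>a\<ge>1. p (Suc a) \<le> p a) \<and> finite {a. p a \<noteq> 0}}"

definition psize :: "(nat \<Rightarrow> nat) \<Rightarrow> nat" where
  "psize p = (\<Sum>a | p a \<noteq> 0. p a)"

definition multipartitions :: "nat \<Rightarrow> (nat \<Rightarrow> nat \<Rightarrow> nat) set" where
  "multipartitions l =
     {lam. (\<forall>j\<in>{1..l}. lam j \<in> partitions) \<and> (\<forall>j. j \<notin> {1..l} \<longrightarrow> lam j = (\<lambda>_. 0))}"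

definition multipartitions_of :: "nat \<Rightarrow> nat \<Rightarrow> (nat \<Rightarrow> nat \<Rightarrow> nat) set" where
  "multipartitions_of l n = {lam \<in> multipartitions l. (\<Sum>j=1..l. psize (lam j)) = n}"

definition beta :: "int \<Rightarrow> (nat \<Rightarrow> nat) \<Rightarrow> int set" where
  "beta t p = {int (p a) + t - int a | a. 1 \<le> a}"

definition charge :: "int set \<Rightarrow> int" where
  "charge B = int (card (B \<inter> {0..})) - int (card ({..<0} - B))"

section \<open>Weights\<close>

definition runner :: "nat \<Rightarrow> int set \<Rightarrow> nat \<Rightarrow> int set" where
  "runner e B i = {a. a * int e + int i \<in> B}"

text \<open>The \<open>a\<close>-th largest element of a beta-set, for \<open>a \<ge> 1\<close>.\<close>

definition nth_largest :: "int set \<Rightarrow> nat \<Rightarrow> int" where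
  "nth_largest B a = (THE b. b \<in> B \<and> Suc (card {x \<in> B. b < x}) = a)"

text \<open>All but finitely many terms of the inner sum vanish; it is the sum of the nonzero ones.\<close>

definition wt_beta :: "nat \<Rightarrow> int set \<Rightarrow> int" where
  "wt_beta e B =
     (\<Sum>i<e. \<Sum>a | 1 \<le> a \<and> nth_largest (runner e B i) a - charge (runner e B i) + int a \<noteq> 0.
        nth_largest (runner e B i) a - charge (runner e B i) + int a)"

definition upsilon :: "nat \<Rightarrow> nat \<Rightarrow> nat \<Rightarrow> int \<Rightarrow> int" where
  "upsilon e l j x =
     (x div int e) * int e * int l + (int l - int j) * int e + x mod int e"

definition uglov :: "nat \<Rightarrow> nat \<Rightarrow> (nat \<Rightarrow> int set) \<Rightarrow> int set" where
  "uglov e l Bs = (\<Union>j\<in>{1..l}. upsilon e l j ` Bs j)"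

definition wt_multi :: "nat \<Rightarrow> nat \<Rightarrow> (nat \<Rightarrow> nat \<Rightarrow> nat) \<Rightarrow> (nat \<Rightarrow> int) \<Rightarrow> int" where
  "wt_multi e l lam t = wt_beta e (uglov e l (\<lambda>j. beta (t j) (lam j)))"

text \<open>The orbit of \<open>(lam; r)\<close> under the right action of the extended affine Weyl group.\<close>

definition weyl_orbit ::
  "nat \<Rightarrow> nat \<Rightarrow> (nat \<Rightarrow> int) \<Rightarrow> (nat \<Rightarrow> nat \<Rightarrow> nat) \<Rightarrow> ((nat \<Rightarrow> nat \<Rightarrow> nat) \<times> (nat \<Rightarrow> int)) set" where
  "weyl_orbit e l r lam =
     {(\<lambda>j. lam (\<sigma> j), \<lambda>j. r (\<sigma> j) + int e * u j) | \<sigma> u. \<sigma> permutes {1..l}}"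

definition wt_hecke :: "nat \<Rightarrow> nat \<Rightarrow> (nat \<Rightarrow> int) \<Rightarrow> (nat \<Rightarrow> nat \<Rightarrow> nat) \<Rightarrow> int" where
  "wt_hecke e l r lam = (LEAST w. \<exists>(\<nu>, v) \<in> weyl_orbit e l r lam. w = wt_multi e l \<nu> v)"

section \<open>Nodes\<close>

type_synonym node = "nat \<times> nat \<times> nat"

definition young :: "nat \<Rightarrow> (nat \<Rightarrow> nat \<Rightarrow> nat) \<Rightarrow> node set" where
  "young l lam = {(a, b, j). 1 \<le> a \<and> 1 \<le> b \<and> 1 \<le> j \<and> j \<le> l \<and> b \<le> lam j a}"

text \<open>Residues modulo \<open>e\<close> are represented by integers in \<open>{0..<e}\<close>.\<close>

definition residue :: "nat \<Rightarrow> (nat \<Rightarrow> int) \<Rightarrow> node \<Rightarrow> int" where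
  "residue e r = (\<lambda>(a, b, j). (int b - int a + r j) mod int e)"

definition removable ::
  "nat \<Rightarrow> nat \<Rightarrow> (nat \<Rightarrow> int) \<Rightarrow> int \<Rightarrow> (nat \<Rightarrow> nat \<Rightarrow> nat) \<Rightarrow> node set" where
  "removable e l r i lam =
     {x \<in> young l lam. residue e r x = i \<and> (\<exists>mu\<in>multipartitions l. young l mu = young l lam - {x})}"

definition addable ::
  "nat \<Rightarrow> nat \<Rightarrow> (nat \<Rightarrow> int) \<Rightarrow> int \<Rightarrow> (nat \<Rightarrow> nat \<Rightarrow> nat) \<Rightarrow> node set" where
  "addable e l r i mu =
     {x. \<exists>lam\<in>multipartitions l. x \<in> removable e l r i lam \<and> young l mu = young l lam - {x}}"

definition delta ::
  "nat \<Rightarrow> nat \<Rightarrow> (nat \<Rightarrow> int) \<Rightarrow> int \<Rightarrow> (nat \<Rightarrow> nat \<Rightarrow> nat) \<Rightarrow> int" where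
  "delta e l r i lam = int (card (removable e l r i lam)) - int (card (addable e l r i lam))"

definition reflect ::
  "nat \<Rightarrow> nat \<Rightarrow> (nat \<Rightarrow> int) \<Rightarrow> int \<Rightarrow> (nat \<Rightarrow> nat \<Rightarrow> nat) \<Rightarrow> (nat \<Rightarrow> nat \<Rightarrow> nat)" where
  "reflect e l r i lam =
     (THE mu. mu \<in> multipartitions l \<and>
        young l mu = (young l lam - removable e l r i lam) \<union> addable e l r i lam)"

section \<open>Ariki-Koike algebras\<close>

text \<open>
  The free associative algebra on generators \<open>X 0, X 1, \<dots>\<close> consists of the finitely supported
  functions on words; words form a monoid, written additively because this is what the
  multiplication of \<^type>\<open>poly_mapping\<close> requires.
\<close>

datatype gword = Word (letters: "nat list")

instantiation gword :: monoid_add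
begin
definition zero_gword :: gword where "0 = Word []"
definition plus_gword :: "gword \<Rightarrow> gword \<Rightarrow> gword" where
  "u + v = Word (letters u @ letters v)"
instance by standard (simp_all add: zero_gword_def plus_gword_def)
end

definition gen :: "nat \<Rightarrow> gword \<Rightarrow>\<^sub>0 'f::field" where
  "gen i = Poly_Mapping.single (Word [i]) 1"

definition const :: "'f \<Rightarrow> gword \<Rightarrow>\<^sub>0 'f::field" where
  "const c = Poly_Mapping.single 0 c"

definition free_algebra :: "nat \<Rightarrow> (gword \<Rightarrow>\<^sub>0 'f::field) ring" where
  "free_algebra n =
     \<lparr>carrier = {p. \<forall>u\<in>Poly_Mapping.keys p. set (letters u) \<subseteq> {..<n}},
      monoid.mult = (*), one = 1, ring.zero = 0, add = (+)\<rparr>"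

inductive_set ak_relations ::
  "nat \<Rightarrow> 'f::field \<Rightarrow> (nat \<Rightarrow> int) \<Rightarrow> nat \<Rightarrow> (gword \<Rightarrow>\<^sub>0 'f) set"
  for l q r n where
  cyclotomic: "0 < n \<Longrightarrow>
    prod_list (map (\<lambda>j. gen 0 - const (q powi r j)) [1..<Suc l]) \<in> ak_relations l q r n"
| quadratic: "1 \<le> a \<Longrightarrow> a < n \<Longrightarrow> (gen a - const q) * (gen a + 1) \<in> ak_relations l q r n"
| braid0: "2 \<le> n \<Longrightarrow>
    gen 0 * gen 1 * gen 0 * gen 1 - gen 1 * gen 0 * gen 1 * gen 0 \<in> ak_relations l q r n"
| braid: "1 \<le> a \<Longrightarrow> Suc a < n \<Longrightarrow>
    gen a * gen (Suc a) * gen a - gen (Suc a) * gen a * gen (Suc a) \<in> ak_relations l q r n"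
| comm: "a < n \<Longrightarrow> b < n \<Longrightarrow> a + 2 \<le> b \<or> b + 2 \<le> a \<Longrightarrow>
    gen a * gen b - gen b * gen a \<in> ak_relations l q r n"

definition ak_ideal :: "nat \<Rightarrow> 'f::field \<Rightarrow> (nat \<Rightarrow> int) \<Rightarrow> nat \<Rightarrow> (gword \<Rightarrow>\<^sub>0 'f) set" where
  "ak_ideal l q r n = Idl\<^bsub>free_algebra n\<^esub> (ak_relations l q r n)"

type_synonym 'f ak = "(gword \<Rightarrow>\<^sub>0 'f) set"

text \<open>For \<open>n = 0\<close> there are neither generators nor relations, so this is the ground field.\<close>

definition AK :: "nat \<Rightarrow> 'f::field \<Rightarrow> (nat \<Rightarrow> int) \<Rightarrow> nat \<Rightarrow> 'f ak ring" where
  "AK l q r n = free_algebra n Quot ak_ideal l q r n"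

definition ak_class ::
  "nat \<Rightarrow> 'f::field \<Rightarrow> (nat \<Rightarrow> int) \<Rightarrow> nat \<Rightarrow> (gword \<Rightarrow>\<^sub>0 'f) \<Rightarrow> 'f ak" where
  "ak_class l q r n x = ak_ideal l q r n +>\<^bsub>free_algebra n\<^esub> x"

abbreviation ak_T :: "nat \<Rightarrow> 'f::field \<Rightarrow> (nat \<Rightarrow> int) \<Rightarrow> nat \<Rightarrow> nat \<Rightarrow> 'f ak" where
  "ak_T l q r n i \<equiv> ak_class l q r n (gen i)"

abbreviation ak_scalar :: "nat \<Rightarrow> 'f::field \<Rightarrow> (nat \<Rightarrow> int) \<Rightarrow> nat \<Rightarrow> 'f \<Rightarrow> 'f ak" where
  "ak_scalar l q r n c \<equiv> ak_class l q r n (const c)"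

text \<open>
  The anti-automorphism fixing the generators is induced by the reversal of words.  Reversal
  preserves the defining ideal, so its image of a coset is again a coset.
\<close>

definition rev_word :: "gword \<Rightarrow> gword" where
  "rev_word u = Word (rev (letters u))"

definition ak_star :: "'f::field ak \<Rightarrow> 'f ak" where
  "ak_star x = Poly_Mapping.map_key rev_word ` x"

definition prod_in :: "('a, 'b) monoid_scheme \<Rightarrow> 'a list \<Rightarrow> 'a" where
  "prod_in G xs = foldr (\<lambda>x y. x \<otimes>\<^bsub>G\<^esub> y) xs \<one>\<^bsub>G\<^esub>"

text \<open>Jucys-Murphy elements \<open>L k\<close> for \<open>1 \<le> k \<le> n\<close>; the index 0 is not used.\<close>

fun jucys_murphy :: "nat \<Rightarrow> 'f::field \<Rightarrow> (nat \<Rightarrow> int) \<Rightarrow> nat \<Rightarrow> nat \<Rightarrow> 'f ak" where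
  "jucys_murphy l q r n 0 = \<one>\<^bsub>AK l q r n\<^esub>"
| "jucys_murphy l q r n (Suc 0) = ak_T l q r n 0"
| "jucys_murphy l q r n (Suc (Suc k)) =
     ak_scalar l q r n (inverse q) \<otimes>\<^bsub>AK l q r n\<^esub> ak_T l q r n (Suc k) \<otimes>\<^bsub>AK l q r n\<^esub>
       jucys_murphy l q r n (Suc k) \<otimes>\<^bsub>AK l q r n\<^esub> ak_T l q r n (Suc k)"

text \<open>
  Permutations act from the right: the product \<open>s\<^sub>i s\<^sub>j\<close> first applies \<open>s\<^sub>i\<close>.
\<close>

fun word_perm :: "nat list \<Rightarrow> nat \<Rightarrow> nat" where
  "word_perm [] = id"
| "word_perm (i # is) = word_perm is \<circ> Transposition.transpose i (Suc i)"

definition reduced_expr :: "nat \<Rightarrow> (nat \<Rightarrow> nat) \<Rightarrow> nat list \<Rightarrow> bool" where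
  "reduced_expr n w is \<longleftrightarrow> set is \<subseteq> {1..<n} \<and> word_perm is = w \<and>
     (\<forall>js. set js \<subseteq> {1..<n} \<and> word_perm js = w \<longrightarrow> length is \<le> length js)"

text \<open>By Matsumoto's theorem the choice of the reduced expression is immaterial.\<close>

definition ak_Tperm ::
  "nat \<Rightarrow> 'f::field \<Rightarrow> (nat \<Rightarrow> int) \<Rightarrow> nat \<Rightarrow> (nat \<Rightarrow> nat) \<Rightarrow> 'f ak" where
  "ak_Tperm l q r n w =
     prod_in (AK l q r n) (map (ak_T l q r n) (SOME is. reduced_expr n w is))"

section \<open>Specht modules\<close>

definition dominates :: "nat \<Rightarrow> (nat \<Rightarrow> nat \<Rightarrow> nat) \<Rightarrow> (nat \<Rightarrow> nat \<Rightarrow> nat) \<Rightarrow> bool" where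
  "dominates l mu lam \<longleftrightarrow>
     (\<forall>s\<in>{1..l}. \<forall>m. (\<Sum>j\<in>{1..<s}. psize (lam j)) + (\<Sum>a=1..m. lam s a)
                 \<le> (\<Sum>j\<in>{1..<s}. psize (mu j)) + (\<Sum>a=1..m. mu s a))"

definition initial_tableau :: "(nat \<Rightarrow> nat \<Rightarrow> nat) \<Rightarrow> node \<Rightarrow> nat" where
  "initial_tableau lam =
     (\<lambda>(a, b, j). (\<Sum>j'\<in>{1..<j}. psize (lam j')) + (\<Sum>a'\<in>{1..<a}. lam j a') + b)"

definition row_stabiliser :: "nat \<Rightarrow> nat \<Rightarrow> (nat \<Rightarrow> nat \<Rightarrow> nat) \<Rightarrow> (nat \<Rightarrow> nat) set" where
  "row_stabiliser l n lam =
     {w. w permutes {1..n} \<and>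
         (\<forall>(a, b, j)\<in>young l lam. \<exists>b'. (a, b', j) \<in> young l lam \<and>
            w (initial_tableau lam (a, b, j)) = initial_tableau lam (a, b', j))}"

text \<open>Only the values of a tableau on the diagram of its shape matter.\<close>

definition standard_tableau :: "nat \<Rightarrow> nat \<Rightarrow> (nat \<Rightarrow> nat \<Rightarrow> nat) \<Rightarrow> (node \<Rightarrow> nat) \<Rightarrow> bool" where
  "standard_tableau l n lam t \<longleftrightarrow>
     bij_betw t (young l lam) {1..n} \<and>
     (\<forall>a b j. (a, b, j) \<in> young l lam \<and> (a, Suc b, j) \<in> young l lam
        \<longrightarrow> t (a, b, j) < t (a, Suc b, j)) \<and>
     (\<forall>a b j. (a, b, j) \<in> young l lam \<and> (Suc a, b, j) \<in> young l lam
        \<longrightarrow> t (a, b, j) < t (Suc a, b, j))"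

definition tableau_perm ::
  "nat \<Rightarrow> nat \<Rightarrow> (nat \<Rightarrow> nat \<Rightarrow> nat) \<Rightarrow> (node \<Rightarrow> nat) \<Rightarrow> nat \<Rightarrow> nat" where
  "tableau_perm l n lam t =
     (THE d. d permutes {1..n} \<and> (\<forall>x\<in>young l lam. t x = d (initial_tableau lam x)))"

definition m_elem ::
  "nat \<Rightarrow> 'f::field \<Rightarrow> (nat \<Rightarrow> int) \<Rightarrow> nat \<Rightarrow> (nat \<Rightarrow> nat \<Rightarrow> nat) \<Rightarrow> 'f ak" where
  "m_elem l q r n lam =
     prod_in (AK l q r n)
       [jucys_murphy l q r n k \<ominus>\<^bsub>AK l q r n\<^esub> ak_scalar l q r n (q powi r s).
          s \<leftarrow> [2..<Suc l], k \<leftarrow> [1..<Suc (\<Sum>j\<in>{1..<s}. psize (lam j))]]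
     \<otimes>\<^bsub>AK l q r n\<^esub> (\<Oplus>\<^bsub>AK l q r n\<^esub>w\<in>row_stabiliser l n lam. ak_Tperm l q r n w)"

definition murphy_elem ::
  "nat \<Rightarrow> 'f::field \<Rightarrow> (nat \<Rightarrow> int) \<Rightarrow> nat \<Rightarrow> (nat \<Rightarrow> nat \<Rightarrow> nat)
     \<Rightarrow> (node \<Rightarrow> nat) \<Rightarrow> (node \<Rightarrow> nat) \<Rightarrow> 'f ak" where
  "murphy_elem l q r n lam s t =
     ak_star (ak_Tperm l q r n (tableau_perm l n lam s)) \<otimes>\<^bsub>AK l q r n\<^esub> m_elem l q r n lam
       \<otimes>\<^bsub>AK l q r n\<^esub> ak_Tperm l q r n (tableau_perm l n lam t)"

text \<open>A linear span: the additive subgroup generated by all scalar multiples.\<close>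

definition cell_ideal ::
  "nat \<Rightarrow> 'f::field \<Rightarrow> (nat \<Rightarrow> int) \<Rightarrow> nat \<Rightarrow> (nat \<Rightarrow> nat \<Rightarrow> nat) \<Rightarrow> 'f ak set" where
  "cell_ideal l q r n lam =
     generate (add_monoid (AK l q r n))
       {ak_scalar l q r n c \<otimes>\<^bsub>AK l q r n\<^esub> murphy_elem l q r n mu s t | c mu s t.
          mu \<in> multipartitions_of l n \<and> dominates l mu lam \<and> mu \<noteq> lam \<and>
          standard_tableau l n mu s \<and> standard_tableau l n mu t}"

text \<open>
  HOL-Algebra has no modules over noncommutative rings.  We store right modules in its module
  record, reading \<open>h \<odot> x\<close> as the right action of \<open>h\<close> on \<open>x\<close>; the fields
  \<open>mult\<close> and \<open>one\<close> play no role.  Since the cell ideal \<open>N\<close> is two-sided, \<open>h\<close>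
  acts on the quotient by right multiplication with the coset of \<open>h\<close>.
\<close>

definition specht_module ::
  "nat \<Rightarrow> 'f::field \<Rightarrow> (nat \<Rightarrow> int) \<Rightarrow> nat \<Rightarrow> (nat \<Rightarrow> nat \<Rightarrow> nat) \<Rightarrow> ('f ak, 'f ak set) module" where
  "specht_module l q r n lam =
     (let H = AK l q r n; N = cell_ideal l q r n lam; Q = H Quot N;
          act = (\<lambda>h x. x \<otimes>\<^bsub>Q\<^esub> (N +>\<^bsub>H\<^esub> h))
      in \<lparr>carrier = {act h (N +>\<^bsub>H\<^esub> m_elem l q r n lam) | h. h \<in> carrier H},
          monoid.mult = undefined, one = undefined, ring.zero = \<zero>\<^bsub>Q\<^esub>, add = add Q, smult = act\<rparr>)"

section \<open>Blocks\<close>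

definition direct_sum_ideals :: "('a, 'b) ring_scheme \<Rightarrow> 'a set \<Rightarrow> 'a set \<Rightarrow> 'a set \<Rightarrow> bool" where
  "direct_sum_ideals A K I J \<longleftrightarrow>
     ideal I A \<and> ideal J A \<and> I \<inter> J = {\<zero>\<^bsub>A\<^esub>} \<and> I <+>\<^bsub>A\<^esub> J = K"

text \<open>The blocks of a ring are its indecomposable two-sided direct summands.\<close>

definition ring_blocks :: "('a, 'b) ring_scheme \<Rightarrow> 'a set set" where
  "ring_blocks A =
     {B. B \<noteq> {\<zero>\<^bsub>A\<^esub>} \<and> (\<exists>J. direct_sum_ideals A (carrier A) B J) \<and>
         (\<forall>I J. direct_sum_ideals A B I J \<longrightarrow> I = {\<zero>\<^bsub>A\<^esub>} \<or> J = {\<zero>\<^bsub>A\<^esub>})}"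

text \<open>
  A right module belongs to a block (equivalently, all its composition factors do) iff the
  identity element of the block acts on it as the identity.
\<close>

definition belongs_to_block ::
  "('a, 'b) ring_scheme \<Rightarrow> 'a set \<Rightarrow> ('a, 'm) module \<Rightarrow> bool" where
  "belongs_to_block A B M \<longleftrightarrow>
     (\<exists>\<epsilon>\<in>B. (\<forall>b\<in>B. \<epsilon> \<otimes>\<^bsub>A\<^esub> b = b \<and> b \<otimes>\<^bsub>A\<^esub> \<epsilon> = b) \<and>
        (\<forall>x\<in>carrier M. \<epsilon> \<odot>\<^bsub>M\<^esub> x = x))"

text \<open>
  Blocks of the family of all algebras \<open>AK l q r n\<close>, tagged by \<open>n\<close>.
\<close>

type_synonym 'f ak_block = "nat \<times> 'f ak set"

definition ak_blocks :: "nat \<Rightarrow> 'f::field \<Rightarrow> (nat \<Rightarrow> int) \<Rightarrow> 'f ak_block set" where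
  "ak_blocks l q r = {(n, B). B \<in> ring_blocks (AK l q r n)}"

definition lying_in ::
  "nat \<Rightarrow> 'f::field \<Rightarrow> (nat \<Rightarrow> int) \<Rightarrow> 'f ak_block \<Rightarrow> (nat \<Rightarrow> nat \<Rightarrow> nat) set" where
  "lying_in l q r = (\<lambda>(n, B).
     {lam \<in> multipartitions_of l n. belongs_to_block (AK l q r n) B (specht_module l q r n lam)})"

section \<open>Reflections of blocks, pairs and Scopes equivalence\<close>

text \<open>
  The weight and the numbers \<open>\<delta>\<^sub>i\<close> of a block are the common values of the respective
  functions on the multipartitions lying in it.  That these are constant is a theorem, so they
  are specified as relations.
\<close>

definition block_wt ::
  "nat \<Rightarrow> nat \<Rightarrow> 'f::field \<Rightarrow> (nat \<Rightarrow> int) \<Rightarrow> 'f ak_block \<Rightarrow> int \<Rightarrow> bool" where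
  "block_wt e l q r B w \<longleftrightarrow> wt_hecke e l r ` lying_in l q r B = {w}"

definition block_delta ::
  "nat \<Rightarrow> nat \<Rightarrow> 'f::field \<Rightarrow> (nat \<Rightarrow> int) \<Rightarrow> int \<Rightarrow> 'f ak_block \<Rightarrow> int \<Rightarrow> bool" where
  "block_delta e l q r i B d \<longleftrightarrow> delta e l r i ` lying_in l q r B = {d}"

text \<open>\<open>C = s\<^sub>i \<bullet> B\<close>:\<close>

definition block_refl ::
  "nat \<Rightarrow> nat \<Rightarrow> 'f::field \<Rightarrow> (nat \<Rightarrow> int) \<Rightarrow> int \<Rightarrow> 'f ak_block \<Rightarrow> 'f ak_block \<Rightarrow> bool" where
  "block_refl e l q r i B C \<longleftrightarrow>
     B \<in> ak_blocks l q r \<and> C \<in> ak_blocks l q r \<and>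
     (\<exists>d. block_delta e l q r i B d \<and> int (fst C) = int (fst B) - d) \<and>
     lying_in l q r C = reflect e l r i ` lying_in l q r B"

text \<open>
  Both relations below concern the unordered pair formed by \<open>B\<close> and \<open>s\<^sub>i \<bullet> B\<close>
  (reflection by \<open>s\<^sub>i\<close> is an involution).
\<close>

definition wk_pair ::
  "nat \<Rightarrow> nat \<Rightarrow> 'f::field \<Rightarrow> (nat \<Rightarrow> int) \<Rightarrow> int \<Rightarrow> int \<Rightarrow> 'f ak_block \<Rightarrow> 'f ak_block \<Rightarrow> bool" where
  "wk_pair e l q r w k = symclp (\<lambda>B C.
     B \<noteq> C \<and> (\<exists>i\<in>{0..<int e}. block_refl e l q r i B C \<and>
       block_wt e l q r B w \<and> (\<exists>d. block_delta e l q r i B d \<and> k = \<bar>d\<bar>)))"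

definition scopes_step ::
  "nat \<Rightarrow> nat \<Rightarrow> 'f::field \<Rightarrow> (nat \<Rightarrow> int) \<Rightarrow> 'f ak_block \<Rightarrow> 'f ak_block \<Rightarrow> bool" where
  "scopes_step e l q r B C \<longleftrightarrow>
     (\<exists>i\<in>{0..<int e}. block_refl e l q r i B C \<and>
       ((\<forall>lam\<in>lying_in l q r B. addable e l r i lam = {}) \<or>
        (\<forall>lam\<in>lying_in l q r B. removable e l r i lam = {})))"

definition scopes_equivalent ::
  "nat \<Rightarrow> nat \<Rightarrow> 'f::field \<Rightarrow> (nat \<Rightarrow> int) \<Rightarrow> 'f ak_block \<Rightarrow> 'f ak_block \<Rightarrow> bool" where
  "scopes_equivalent e l q r = equivclp (scopes_step e l q r)"

definition primitive_root :: "nat \<Rightarrow> 'f::field \<Rightarrow> bool" where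
  "primitive_root e q \<longleftrightarrow> q ^ e = 1 \<and> (\<forall>m. 0 < m \<and> m < e \<longrightarrow> q ^ m \<noteq> 1)"

section \<open>Well-formedness of the algebras\<close>

lemma ring_free_algebra: "ring (free_algebra n :: (gword \<Rightarrow>\<^sub>0 'f::field) ring)"
proof (rule ringI)
  show "abelian_group (free_algebra n :: (gword \<Rightarrow>\<^sub>0 'f) ring)"
  proof (rule abelian_groupI)
    fix x :: "gword \<Rightarrow>\<^sub>0 'f" assume "x \<in> carrier (free_algebra n)"
    then show "\<exists>y\<in>carrier (free_algebra n). y \<oplus>\<^bsub>free_algebra n\<^esub> x = \<zero>\<^bsub>free_algebra n\<^esub>"
      by (intro bexI[of _ "- x"]) (auto simp: free_algebra_def)
  qed (use Poly_Mapping.keys_add in \<open>fastforce simp: free_algebra_def algebra_simps\<close>)+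
  show "Group.monoid (free_algebra n :: (gword \<Rightarrow>\<^sub>0 'f) ring)"
  proof (rule monoidI)
    fix x y :: "gword \<Rightarrow>\<^sub>0 'f"
    assume "x \<in> carrier (free_algebra n)" "y \<in> carrier (free_algebra n)"
    then show "x \<otimes>\<^bsub>free_algebra n\<^esub> y \<in> carrier (free_algebra n)"
      using Poly_Mapping.keys_mult[of x y]
      by (fastforce simp: free_algebra_def plus_gword_def)
  qed (auto simp: free_algebra_def zero_gword_def algebra_simps)
qed (auto simp: free_algebra_def algebra_simps)

lemma gen_carrier: "i < n \<Longrightarrow> gen i \<in> carrier (free_algebra n)"
  by (auto simp: gen_def free_algebra_def)

lemma const_carrier: "const c \<in> carrier (free_algebra n)"
  by (auto simp: const_def free_algebra_def zero_gword_def)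

lemma free_algebra_closed:
  fixes x y :: "gword \<Rightarrow>\<^sub>0 'f::field"
  assumes "x \<in> carrier (free_algebra n)" "y \<in> carrier (free_algebra n)"
  shows "x + y \<in> carrier (free_algebra n)" "x - y \<in> carrier (free_algebra n)"
    "x * y \<in> carrier (free_algebra n)"
proof -
  interpret ring "free_algebra n :: (gword \<Rightarrow>\<^sub>0 'f) ring" by (rule ring_free_algebra)
  show "x + y \<in> carrier (free_algebra n)" "x * y \<in> carrier (free_algebra n)"
    using a_closed[OF assms] m_closed[OF assms] by (simp_all add: free_algebra_def)
  show "x - y \<in> carrier (free_algebra n)"
    using a_closed[OF assms(1), of "- y"] assms(2) by (simp add: free_algebra_def)
qed

lemma one_carrier: "(1 :: gword \<Rightarrow>\<^sub>0 'f::field) \<in> carrier (free_algebra n)"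
  using ring.ring_simprules(6)[OF ring_free_algebra[of n]] by (simp add: free_algebra_def)

lemma ak_relations_carrier: "ak_relations l q r n \<subseteq> carrier (free_algebra n)"
proof
  fix x assume "x \<in> ak_relations l q r n"
  then show "x \<in> carrier (free_algebra n)"
  proof cases
    case cyclotomic
    have "prod_list (map (\<lambda>j. gen 0 - const (q powi r j)) js) \<in> carrier (free_algebra n)" for js
      using cyclotomic(2)
      by (induction js) (auto intro!: free_algebra_closed gen_carrier const_carrier one_carrier)
    then show ?thesis using cyclotomic(1) by blast
  qed (auto intro!: free_algebra_closed gen_carrier const_carrier one_carrier)
qed

lemma ideal_ak_ideal: "ideal (ak_ideal l q r n) (free_algebra n)"
  unfolding ak_ideal_def
  by (rule ring.genideal_ideal[OF ring_free_algebra ak_relations_carrier])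

lemma ring_AK: "ring (AK l q r n)"
  unfolding AK_def by (rule ideal.quotient_is_ring[OF ideal_ak_ideal])

end

(*
  For a fixed element of the extended affine Weyl group, the weight of the twisted multipartition is
  computed on the e runners of its Uglov beta-set U, and delta_i is the difference of the charges of
  the runners i and i - 1 of U (with a correction by l when i = 0).  Adding an i-node moves one bead
  from runner i - 1 to runner i, which lowers the weight by delta_i + 1.  Take an element attaining
  the minimum w.  If delta_i = k >= 0 and there were an addable i-node, adding it would give weight
  w - k - 1, so w > k because weights are nonnegative; removing a node is the mirror image for
  delta_i = -k.
*)
theory Submission
  imports Defs
begin

section \<open>Beta-sets\<close>

text \<open>Adding a bead at \<open>p\<close> to a beta-set of charge \<open>c\<close> raises its
  size by \<open>p - c\<close>, wherever \<open>p\<close> lies. Under the Uglov map the entry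
  \<open>a * e + b\<close> of component \<open>j\<close> sits on runner \<open>b\<close> at position
  \<open>a * l + (l - j)\<close>, so a bead passing to the next residue keeps its position, except
  that it climbs \<open>l\<close> places when the residue wraps round from \<open>e - 1\<close> to
  \<open>0\<close>; this is the source of the correction by \<open>l\<close>. In the change of
  weight the position of the bead cancels and only charges survive. Minima over the orbits of two
  multipartitions are never compared: the same group element is applied to both, and for the second
  one nonnegativity is enough. In the mirror case the formula is read backwards from the smaller
  multipartition, whose \<open>delta\<close> is lower by 2; this gives it the weight
  \<open>w + delta - 1\<close>, with \<open>delta\<close> that of the larger one.\<close>

definition beta_set :: "int set \<Rightarrow> bool" where
  "beta_set R \<longleftrightarrow> (\<exists>c m. {..<c} \<subseteq> R \<and> R \<subseteq> {..<m})"

lemma beta_setI: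
  assumes "\<And>x. x < c \<Longrightarrow> x \<in> R" "\<And>x. x \<in> R \<Longrightarrow> x < m"
  shows "beta_set R"
  using assms unfolding beta_set_def by (meson lessThan_iff subsetI)

lemma beta_setE:
  assumes "beta_set R"
  obtains c m where "\<And>x. x \<notin> R \<Longrightarrow> c \<le> x" "\<And>x. x \<in> R \<Longrightarrow> x < m"
proof -
  obtain c m where "{..<c} \<subseteq> R" "R \<subseteq> {..<m}"
    using assms unfolding beta_set_def by blast
  then show thesis
    by (metis that in_mono lessThan_iff not_less)
qed

lemma beta_set_lessThan: "beta_set {..<c}"
  unfolding beta_set_def by blast

lemma beta_set_insert:
  assumes "beta_set R"
  shows "beta_set (insert p R)"
proof -
  obtain c m where "{..<c} \<subseteq> R" "R \<subseteq> {..<m}"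
    using assms by (auto simp: beta_set_def)
  then have "{..<c} \<subseteq> insert p R" "insert p R \<subseteq> {..<max m (p + 1)}"
    by fastforce+
  then show ?thesis
    unfolding beta_set_def by blast
qed

lemma beta_set_Int:
  assumes "beta_set A" "beta_set B"
  shows "beta_set (A \<inter> B)"
proof -
  obtain c m c' where "{..<c} \<subseteq> A" "A \<subseteq> {..<m}" "{..<c'} \<subseteq> B"
    using assms by (auto simp: beta_set_def)
  then have "{..<min c c'} \<subseteq> A \<inter> B" "A \<inter> B \<subseteq> {..<m}"
    by auto
  then show ?thesis
    unfolding beta_set_def by blast
qed

lemma beta_set_translate:
  assumes "beta_set R"
  shows "beta_set {p. p + k \<in> R}"
proof -
  obtain c m where "{..<c} \<subseteq> R" "R \<subseteq> {..<m}"
    using assms by (auto simp: beta_set_def)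
  then have "{..<c - k} \<subseteq> {p. p + k \<in> R}" "{p. p + k \<in> R} \<subseteq> {..<m - k}"
    by force+
  then show ?thesis
    unfolding beta_set_def by blast
qed

lemma beta_set_finite:
  assumes "beta_set R"
  shows "finite (R \<inter> {b..})" "finite {x \<in> R. b < x}" "finite ({..<b} - R)"
proof -
  obtain c m where cm: "\<And>x. x \<notin> R \<Longrightarrow> c \<le> x" "\<And>x. x \<in> R \<Longrightarrow> x < m"
    by (rule beta_setE[OF assms]) blast
  have "R \<inter> {b..} \<subseteq> {b..<m}" "{x \<in> R. b < x} \<subseteq> {b..<m}" "{..<b} - R \<subseteq> {c..<b}"
    by (auto intro: cm)
  then show "finite (R \<inter> {b..})" "finite {x \<in> R. b < x}" "finite ({..<b} - R)"
    by (auto intro: finite_subset)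
qed

lemma beta_set_finite_Diff:
  assumes "beta_set A" "beta_set B"
  shows "finite (A - B)"
proof -
  obtain c where c: "\<And>x. x \<notin> B \<Longrightarrow> c \<le> x"
    by (rule beta_setE[OF assms(2)]) blast
  obtain m where m: "\<And>x. x \<in> A \<Longrightarrow> x < m"
    by (rule beta_setE[OF assms(1)]) blast
  have "A - B \<subseteq> {c..<m}"
    by (auto intro: c m)
  then show ?thesis
    by (rule finite_subset) simp
qed

text \<open>A beta-set is a half-line with finitely many beads above it. Adding these from the
  lowest to the highest always inserts a new maximum, which keeps the indices of the other beads
  under control.\<close>

lemma beta_set_induct [consumes 1, case_names lessThan insert]:
  assumes "beta_set R"
    and base: "\<And>c. P {..<c}"
    and step: "\<And>R p. beta_set R \<Longrightarrow> P R \<Longrightarrow> \<forall>x\<in>R. x < p \<Longrightarrow> P (insert p R)"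
  shows "P R"
proof -
  obtain c m where c: "{..<c} \<subseteq> R" "R \<subseteq> {..<m}"
    using assms(1) by (auto simp: beta_set_def)
  have "F \<subseteq> {c..} \<longrightarrow> beta_set ({..<c} \<union> F) \<and> P ({..<c} \<union> F)" if "finite F" for F
    using that
  proof (induction rule: finite_linorder_max_induct)
    case empty
    then show ?case by (simp add: base beta_set_lessThan)
  next
    case (insert b F)
    then show ?case
      by (auto intro!: step beta_set_insert)
  qed
  moreover have "{..<c} \<union> (R \<inter> {c..}) = R"
    using c by auto
  ultimately show ?thesis
    using beta_set_finite(1)[OF assms(1), of c] by (metis inf_le2)
qed

lemma charge_lessThan: "charge {..<c} = c"
proof (cases "c \<ge> 0")
  case True
  then have "{..<c} \<inter> {0..} = {0..<c}" "{..<0} - {..<c} = {}"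
    by auto
  then show ?thesis
    using True by (simp add: charge_def)
next
  case False
  then have "{..<c} \<inter> {0..} = {}" "{..<0} - {..<c} = {c..<0}"
    by auto
  then show ?thesis
    using False by (simp add: charge_def)
qed

lemma charge_insert:
  assumes "beta_set R" "p \<notin> R"
  shows "charge (insert p R) = charge R + 1"
proof (cases "p \<ge> 0")
  case True
  then have "insert p R \<inter> {0..} = insert p (R \<inter> {0..})" "{..<0} - insert p R = {..<0} - R"
    by auto
  then show ?thesis
    using assms beta_set_finite[OF assms(1)] by (simp add: charge_def)
next
  case False
  then have "insert p R \<inter> {0..} = R \<inter> {0..}" "{..<0} - insert p R = {..<0} - R - {p}"
    by auto
  moreover have "card ({..<0} - R) = Suc (card ({..<0} - R - {p}))"
    using False assms beta_set_finite(3)[OF assms(1)] by (intro card.remove) auto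
  ultimately show ?thesis
    by (simp add: charge_def)
qed

text \<open>Both sets arise from \<open>A \<inter> B\<close> by adding finitely many beads, each
  raising the charge by one. This is the bridge from counting nodes to comparing runners: nodes will
  be counted by the two set differences.\<close>

lemma charge_Diff:
  assumes "beta_set A" "beta_set B"
  shows "charge A - charge B = int (card (A - B)) - int (card (B - A))"
proof -
  have union: "beta_set (R \<union> F) \<and> charge (R \<union> F) = charge R + int (card F)"
    if "finite F" "R \<inter> F = {}" "beta_set R" for R F
    using that
    by (induction rule: finite_induct) (auto simp: charge_insert beta_set_insert)
  have "charge ((A \<inter> B) \<union> (A - B)) = charge (A \<inter> B) + int (card (A - B))"
    using assms by (intro conjunct2[OF union] beta_set_finite_Diff beta_set_Int) auto
  moreover have "charge ((A \<inter> B) \<union> (B - A)) = charge (A \<inter> B) + int (card (B - A))"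
    using assms by (intro conjunct2[OF union] beta_set_finite_Diff beta_set_Int) auto
  moreover have "(A \<inter> B) \<union> (A - B) = A" "(A \<inter> B) \<union> (B - A) = B"
    by auto
  ultimately show ?thesis
    by simp
qed

lemma charge_translate:
  assumes "beta_set R"
  shows "charge {p. p + k \<in> R} = charge R - k"
  using assms
proof (induction rule: beta_set_induct)
  case (lessThan c)
  have "{p. p + k \<in> {..<c}} = {..<c - k}"
    by auto
  then show ?case
    by (simp add: charge_lessThan)
next
  case (insert R b)
  have "{p. p + k \<in> insert b R} = insert (b - k) {p. p + k \<in> R}"
    by auto
  moreover have "b \<notin> R"
    using insert by auto
  ultimately show ?case
    using insert by (simp add: charge_insert beta_set_translate)
qed

text \<open>Among the beta-sets below \<open>p\<close> the half-line has the largest charge. Because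
  of this bound each new top bead contributes a nonnegative amount to the size.\<close>

lemma charge_le:
  assumes "beta_set R" "\<forall>x\<in>R. x < p"
  shows "charge R \<le> p"
  using assms
proof (induction arbitrary: p rule: beta_set_induct)
  case (lessThan c)
  then have "c - 1 < p"
    by simp
  then show ?case
    by (simp add: charge_lessThan)
next
  case (insert R b)
  then have "b \<notin> R" "charge R \<le> b" "b < p"
    by auto
  then show ?case
    using insert.hyps(1) by (simp add: charge_insert)
qed

section \<open>The size of the partition of a beta-set\<close>

text \<open>If \<open>R\<close> is \<open>beta t p\<close> for a partition \<open>p\<close>, then
  \<open>t\<close> is its charge and \<open>p a + t - a\<close> its \<open>a\<close>-th largest
  element, so this is the part \<open>p a\<close>.\<close>

definition excess :: "int set \<Rightarrow> nat \<Rightarrow> int" where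
  "excess R a = nth_largest R a - charge R + int a"

definition beta_size :: "int set \<Rightarrow> int" where
  "beta_size R = (\<Sum>a | 1 \<le> a \<and> excess R a \<noteq> 0. excess R a)"

lemma wt_beta_eq: "wt_beta e B = (\<Sum>i<e. beta_size (runner e B i))"
  unfolding wt_beta_def beta_size_def excess_def ..

lemma excess_lessThan:
  assumes "1 \<le> a"
  shows "excess {..<c} a = 0"
proof -
  have "{x \<in> {..<c}. b < x} = {b<..<c}" for b :: int
    by auto
  then have "nth_largest {..<c} a = (THE b. b < c \<and> Suc (nat (c - (b + 1))) = a)"
    by (simp only: nth_largest_def lessThan_iff card_greaterThanLessThan_int)
  also have "\<dots> = c - int a"
  proof (rule the_equality)
    fix b assume "b < c \<and> Suc (nat (c - (b + 1))) = a"
    then show "b = c - int a"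
      by linarith
  qed (use assms in linarith)
  finally show ?thesis
    by (simp add: excess_def charge_lessThan)
qed

text \<open>A new top bead pushes every old bead one index down while the charge grows by one. The
  two shifts cancel: the old parts are kept and a new first part appears.\<close>

lemma excess_insert_max:
  assumes R: "beta_set R" and max: "\<forall>x\<in>R. x < p"
  shows "excess (insert p R) 1 = p - charge R"
    and "1 \<le> a \<Longrightarrow> excess (insert p R) (Suc a) = excess R a"
proof -
  have p: "p \<notin> R" and top: "{x \<in> insert p R. p < x} = {}"
    using max by auto
  define N where "N b = card {x \<in> insert p R. b < x}" for b
  have N_top: "N p = 0"
    unfolding N_def top by simp
  have N: "N b = Suc (card {x \<in> R. b < x})" if "b \<in> R" for b
  proof -
    have "{x \<in> insert p R. b < x} = insert p {x \<in> R. b < x}"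
      using that max by auto
    then show ?thesis
      using p beta_set_finite(2)[OF R, of b] by (simp add: N_def)
  qed
  have nth: "nth_largest (insert p R) a = (THE b. b \<in> insert p R \<and> Suc (N b) = a)" for a
    unfolding nth_largest_def N_def ..
  have "nth_largest (insert p R) 1 = p"
    unfolding nth
  proof (rule the_equality)
    fix b assume "b \<in> insert p R \<and> Suc (N b) = 1"
    then show "b = p"
      using N[of b] by auto
  qed (simp add: N_top)
  then show "excess (insert p R) 1 = p - charge R"
    by (simp add: excess_def charge_insert[OF R p])
  assume a: "1 \<le> a"
  have "(b \<in> insert p R \<and> Suc (N b) = Suc a)
      \<longleftrightarrow> (b \<in> R \<and> Suc (card {x \<in> R. b < x}) = a)" for b
    using N_top N[of b] a p by (cases "b = p") auto
  then have "nth_largest (insert p R) (Suc a) = nth_largest R a"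
    unfolding nth by (simp only: nth_largest_def)
  then show "excess (insert p R) (Suc a) = excess R a"
    by (simp add: excess_def charge_insert[OF R p])
qed

text \<open>Only an inclusion, since the new first part \<open>p - charge R\<close> may be
  zero.\<close>

lemma excess_support_insert_max:
  assumes "beta_set R" "\<forall>x\<in>R. x < p"
  shows "{a. 1 \<le> a \<and> excess (insert p R) a \<noteq> 0}
    \<subseteq> insert 1 (Suc ` {a. 1 \<le> a \<and> excess R a \<noteq> 0})"
proof
  fix a assume a: "a \<in> {a. 1 \<le> a \<and> excess (insert p R) a \<noteq> 0}"
  show "a \<in> insert 1 (Suc ` {a. 1 \<le> a \<and> excess R a \<noteq> 0})"
  proof (cases "a = 1")
    case False
    then obtain a' where "a = Suc a'" "1 \<le> a'"
      using a by (cases a) auto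
    then show ?thesis
      using a excess_insert_max(2)[OF assms] by auto
  qed simp
qed

lemma finite_excess_support:
  assumes "beta_set R"
  shows "finite {a. 1 \<le> a \<and> excess R a \<noteq> 0}"
  using assms
proof (induction rule: beta_set_induct)
  case (lessThan c)
  have "{a. 1 \<le> a \<and> excess {..<c} a \<noteq> 0} = {}"
    using excess_lessThan by auto
  then show ?case
    by (simp only: finite.emptyI)
next
  case (insert R p)
  then show ?case
    by (intro finite_subset[OF excess_support_insert_max]) auto
qed

lemma beta_size_lessThan: "beta_size {..<c} = 0"
  unfolding beta_size_def using excess_lessThan by (intro sum.neutral) auto

lemma beta_size_insert_max:
  assumes R: "beta_set R" and max: "\<forall>x\<in>R. x < p"
  shows "beta_size (insert p R) = beta_size R + p - charge R"
proof -
  let ?S = "{a. 1 \<le> a \<and> excess R a \<noteq> 0}"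
  have fin: "finite ?S"
    by (rule finite_excess_support[OF R])
  have "beta_size (insert p R) = (\<Sum>a\<in>insert 1 (Suc ` ?S). excess (insert p R) a)"
    unfolding beta_size_def using fin excess_support_insert_max[OF R max]
    by (intro sum.mono_neutral_left) auto
  also have "\<dots> = excess (insert p R) 1 + (\<Sum>a\<in>Suc ` ?S. excess (insert p R) a)"
    using fin by (intro sum.insert) auto
  also have "(\<Sum>a\<in>Suc ` ?S. excess (insert p R) a) = (\<Sum>a\<in>?S. excess R a)"
    using excess_insert_max(2)[OF R max] by (subst sum.reindex) auto
  finally show ?thesis
    using excess_insert_max(1)[OF R max] by (simp add: beta_size_def)
qed

text \<open>Two beads give the same total in either order: whichever comes second meets a charge
  that is larger by one. So the increment of a top bead is valid at every position, by inserting
  \<open>p\<close> before the current maximum \<open>b\<close>.\<close>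

lemma beta_size_insert:
  assumes "beta_set R" "p \<notin> R"
  shows "beta_size (insert p R) = beta_size R + p - charge R"
  using assms
proof (induction arbitrary: p rule: beta_set_induct)
  case (lessThan c)
  then show ?case
    by (intro beta_size_insert_max beta_set_lessThan) auto
next
  case (insert R b)
  then have b: "b \<notin> R" and p: "p \<notin> R" "p \<noteq> b"
    by auto
  show ?case
  proof (cases "p < b")
    case True
    have "beta_size (insert b (insert p R)) = beta_size (insert p R) + b - charge (insert p R)"
      using insert True by (intro beta_size_insert_max beta_set_insert) auto
    also have "\<dots> = beta_size R + p - charge R + b - (charge R + 1)"
      using insert.IH[OF p(1)] charge_insert[OF insert.hyps(1) p(1)] by simp
    also have "\<dots> = beta_size (insert b R) + p - charge (insert b R)"
      using insert b by (simp add: beta_size_insert_max charge_insert)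
    finally show ?thesis
      by (simp add: insert_commute)
  next
    case False
    then show ?thesis
      using insert p by (intro beta_size_insert_max beta_set_insert) force+
  qed
qed

lemma beta_size_nonneg:
  assumes "beta_set R"
  shows "0 \<le> beta_size R"
  using assms
proof (induction rule: beta_set_induct)
  case (lessThan c)
  then show ?case
    by (simp add: beta_size_lessThan)
next
  case (insert R p)
  then show ?case
    using charge_le[of R p] by (simp add: beta_size_insert_max)
qed

section \<open>Runners of the Uglov map\<close>

text \<open>A position on a runner of the Uglov set is \<open>a * l + (l - j)\<close>, so its
  residue modulo \<open>l\<close> recovers the component \<open>j\<close>. Several forms are given
  because the index is formed with truncated subtraction.\<close>

lemma component_index:
  assumes "0 < l"
  shows "l - nat (p mod int l) \<in> {1..l}"
    and "int l - int (l - nat (p mod int l)) = p mod int l"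
    and "int (l - (l - nat (p mod int l))) = p mod int l"
proof -
  have "0 \<le> p mod int l" "p mod int l < int l"
    using assms by simp_all
  then obtain m where "p mod int l = int m" "m < l"
    by (metis of_nat_less_iff zero_le_imp_eq_int)
  then show "l - nat (p mod int l) \<in> {1..l}"
    and "int l - int (l - nat (p mod int l)) = p mod int l"
    and "int (l - (l - nat (p mod int l))) = p mod int l"
    by (simp_all add: of_nat_diff)
qed

text \<open>Division by \<open>e\<close> and then by \<open>l\<close> inverts
  \<open>upsilon\<close>: the runner interleaves the \<open>i\<close>-th runners of the components,
  one entry of each in every window of \<open>l\<close> positions.\<close>

lemma runner_uglov:
  assumes "0 < e" "0 < l" "i < e"
  shows "runner e (uglov e l Bs) i
    = {p. (p div int l) * int e + int i \<in> Bs (l - nat (p mod int l))}"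
proof (intro Set.set_eqI iffI)
  fix p assume "p \<in> runner e (uglov e l Bs) i"
  then obtain j x where j: "1 \<le> j" "j \<le> l" and x: "x \<in> Bs j"
    and eq: "p * int e + int i = upsilon e l j x"
    by (auto simp: runner_def uglov_def)
  let ?q = "(x div int e) * int l + int (l - j)"
  have "p * int e + int i = ?q * int e + x mod int e"
    using eq j by (simp add: upsilon_def of_nat_diff algebra_simps)
  moreover have "(p * int e + int i) div int e = p" "(p * int e + int i) mod int e = int i"
    using assms by auto
  moreover have "(?q * int e + x mod int e) div int e = ?q"
      "(?q * int e + x mod int e) mod int e = x mod int e"
    using assms by (simp_all del: of_nat_diff)
  ultimately have p: "p = ?q" and i: "int i = x mod int e"
    by metis+
  have "p div int l = x div int e" "p mod int l = int (l - j)"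
    using assms j unfolding p by (simp_all add: div_add1_eq del: of_nat_diff)
  moreover from this have "l - nat (p mod int l) = j"
    using j by simp
  moreover have "x div int e * int e + int i = x"
    unfolding i by simp
  ultimately show "p \<in> {p. (p div int l) * int e + int i \<in> Bs (l - nat (p mod int l))}"
    using x by simp
next
  fix p assume p: "p \<in> {p. (p div int l) * int e + int i \<in> Bs (l - nat (p mod int l))}"
  let ?j = "l - nat (p mod int l)" and ?x = "(p div int l) * int e + int i"
  have j: "?j \<in> {1..l}" "int l - int ?j = p mod int l"
    using component_index[OF assms(2)] by blast+
  have x: "?x div int e = p div int l" "?x mod int e = int i"
    using assms by auto
  have "upsilon e l ?j ?x = p div int l * int e * int l + p mod int l * int e + int i"
    unfolding upsilon_def x j(2) ..
  also have "\<dots> = (p div int l * int l + p mod int l) * int e + int i"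
    by (simp only: algebra_simps)
  also have "\<dots> = p * int e + int i"
    by simp
  finally show "p \<in> runner e (uglov e l Bs) i"
    using p j(1) unfolding runner_def uglov_def by (force intro: image_eqI[OF sym])
qed

lemma position_component:
  assumes "j \<in> {1..l}"
  shows "(a * int l + int (l - j)) div int l = a"
    and "l - nat ((a * int l + int (l - j)) mod int l) = j"
  using assms by (simp_all add: div_add1_eq del: of_nat_diff)

lemma beta_set_runner_uglov:
  assumes "0 < e" "0 < l" "i < e" and Bs: "\<And>j. j \<in> {1..l} \<Longrightarrow> beta_set (Bs j)"
  shows "beta_set (runner e (uglov e l Bs) i)"
proof -
  have "\<forall>j\<in>{1..l}. \<exists>c. {..<c} \<subseteq> Bs j" "\<forall>j\<in>{1..l}. \<exists>m. Bs j \<subseteq> {..<m}"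
    using Bs unfolding beta_set_def by blast+
  then obtain c m where cm: "\<forall>j\<in>{1..l}. {..<c j} \<subseteq> Bs j" "\<forall>j\<in>{1..l}. Bs j \<subseteq> {..<m j}"
    by metis
  \<comment> \<open>Adding \<open>0\<close> to the candidates forces
    \<open>C \<le> 0 \<le> M\<close>, so that multiplying \<open>C - 1\<close> or
    \<open>M + 1\<close> by \<open>e \<ge> 1\<close> only moves it further out.\<close>
  define C where "C = Min (insert 0 (c ` {1..l}))"
  define M where "M = Max (insert 0 (m ` {1..l}))"
  have C: "C \<le> 0" "C \<le> c j" and M: "0 \<le> M" "m j \<le> M" if "j \<in> {1..l}" for j
    unfolding C_def M_def using that by (simp_all only: Min_le Max_ge finite_insert finite_imageI
        finite_atLeastAtMost insertI1 insertI2 imageI)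
  have C0: "C \<le> 0" and M0: "0 \<le> M"
    using C(1) M(1) assms(2) by force+
  have e: "1 \<le> int e" and i: "int i < int e"
    using assms by auto
  have lower: "p \<in> runner e (uglov e l Bs) i" if "p < (C - 1) * int l" for p
  proof -
    let ?a = "p div int l" and ?j = "l - nat (p mod int l)"
    have j: "?j \<in> {1..l}"
      by (rule component_index(1)[OF assms(2)])
    have "?a * int l \<le> p"
      using assms by (metis div_mult_mod_eq pos_mod_sign of_nat_0_less_iff le_add_same_cancel1)
    then have "?a * int l < (C - 1) * int l"
      using that by linarith
    then have "?a + 1 \<le> C - 1"
      using mult_less_cancel_right_pos[of "int l" ?a "C - 1"] assms by simp
    then have "(?a + 1) * int e \<le> (C - 1) * int e"
      by (intro mult_right_mono) auto
    also have "\<dots> \<le> (C - 1) * 1"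
      using C0 e by (intro mult_left_mono_neg) auto
    finally have "?a * int e + int i < C"
      using i by (simp add: algebra_simps)
    then show ?thesis
      using cm(1) C(2)[OF j] j
      unfolding runner_uglov[OF assms(1-3)] mem_Collect_eq by (meson in_mono lessThan_iff order_less_le_trans)
  qed
  have upper: "p < (M + 1) * int l" if p: "p \<in> runner e (uglov e l Bs) i" for p
  proof (rule ccontr)
    assume "\<not> p < (M + 1) * int l"
    then have "M + 1 \<le> p div int l"
      using assms by (metis div_mult_self1_is_m mult.commute not_less of_nat_0_less_iff zdiv_mono1
          less_numeral_extra(3) nonzero_mult_div_cancel_right)
    then have "(M + 1) * 1 \<le> (p div int l) * int e"
      using M0 e by (intro mult_mono) auto
    moreover have "p div int l * int e + int i < M"
      using p cm(2) M(2) component_index(1)[OF assms(2), of p]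
      unfolding runner_uglov[OF assms(1-3)] mem_Collect_eq by (meson in_mono lessThan_iff order_less_le_trans)
    ultimately show False
      by simp
  qed
  show ?thesis
    by (rule beta_setI) (erule lower, erule upper)
qed

section \<open>Gaps of a beta-set and their residues\<close>

text \<open>
  A node with \<open>b - a + t = z + 1\<close> is removable if the bead \<open>z + 1\<close> of \<open>beta t p\<close> can be moved to
  \<open>z\<close>, and addable if the bead \<open>z\<close> can be moved to \<open>z + 1\<close>; so residue \<open>i\<close> of the node corresponds
  to residue \<open>k = i - 1\<close> of \<open>z\<close>.
\<close>

definition removable_gaps :: "nat \<Rightarrow> nat \<Rightarrow> int set \<Rightarrow> int set" where
  "removable_gaps e k Y = {z. z mod int e = int k \<and> z + 1 \<in> Y \<and> z \<notin> Y}"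

definition addable_gaps :: "nat \<Rightarrow> nat \<Rightarrow> int set \<Rightarrow> int set" where
  "addable_gaps e k Y = {z. z mod int e = int k \<and> z \<in> Y \<and> z + 1 \<notin> Y}"

definition gap_delta :: "nat \<Rightarrow> nat \<Rightarrow> int set \<Rightarrow> int" where
  "gap_delta e k Y = int (card (removable_gaps e k Y)) - int (card (addable_gaps e k Y))"

lemma finite_gaps:
  assumes "beta_set Y"
  shows "finite (removable_gaps e k Y)" "finite (addable_gaps e k Y)"
proof -
  have "removable_gaps e k Y \<subseteq> {p. p + 1 \<in> Y} - Y" "addable_gaps e k Y \<subseteq> Y - {p. p + 1 \<in> Y}"
    by (auto simp: removable_gaps_def addable_gaps_def)
  then show "finite (removable_gaps e k Y)" "finite (addable_gaps e k Y)"
    using beta_set_finite_Diff[OF beta_set_translate[OF assms] assms]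
      beta_set_finite_Diff[OF assms beta_set_translate[OF assms]] finite_subset by blast+
qed

text \<open>A shift by a multiple of \<open>e\<close> carries gaps to gaps of the same residue; this
  is why the summand \<open>e * u\<close> of a twist does not affect \<open>delta\<close>.\<close>

lemma gap_delta_translate:
  "gap_delta e k {x. x - int e * u \<in> Y} = gap_delta e k Y"
proof -
  have mod: "(z - int e * u) mod int e = z mod int e" for z
    by (metis diff_add_cancel mod_mult_self2)
  have card: "card {z. z - c \<in> S} = card S" for c :: int and S
    by (rule bij_betw_same_card[of "\<lambda>z. z - c"], rule bij_betwI[of _ _ _ "\<lambda>z. z + c"]) auto
  have "removable_gaps e k {x. x - int e * u \<in> Y} = {z. z - int e * u \<in> removable_gaps e k Y}"
    "addable_gaps e k {x. x - int e * u \<in> Y} = {z. z - int e * u \<in> addable_gaps e k Y}"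
    by (simp_all add: removable_gaps_def addable_gaps_def mod add_diff_eq diff_add_eq)
  then show ?thesis
    by (simp add: gap_delta_def card)
qed

section \<open>Neighbouring runners and the motion of a bead between them\<close>

context
  fixes e l k :: nat
  assumes e: "2 \<le> e" and l: "1 \<le> l" and k: "k < e"
begin

abbreviation (input) next_runner :: nat where
  "next_runner \<equiv> Suc k mod e"

text \<open>Equals \<open>l\<close> if \<open>k = e - 1\<close> and \<open>0\<close> otherwise:
  passing from residue \<open>e - 1\<close> to \<open>0\<close> raises the quotient by
  \<open>e\<close> by one, which amounts to \<open>l\<close> positions on a runner.\<close>

abbreviation (input) wrap :: int where
  "wrap \<equiv> int (Suc k div e) * int l"

lemma next_position: "(p div int l + int (Suc k div e)) * int e + int next_runner
    = p div int l * int e + int k + 1"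
proof -
  have "int (Suc k div e) * int e + int next_runner = int (Suc k)"
    by (metis of_nat_add of_nat_mult div_mult_mod_eq)
  then show ?thesis
    by (simp add: algebra_simps)
qed

text \<open>Shifted by \<open>wrap\<close>, the next runner lines up with runner \<open>k\<close>:
  the same \<open>p\<close> stands for \<open>z\<close> on runner \<open>k\<close> and for
  \<open>z + 1\<close> in the same component on the next one.\<close>

lemma runner_next:
  "p + wrap \<in> runner e (uglov e l Bs) next_runner
    \<longleftrightarrow> p div int l * int e + int k + 1 \<in> Bs (l - nat (p mod int l))"
proof -
  have "(p + wrap) div int l = p div int l + int (Suc k div e)" "(p + wrap) mod int l = p mod int l"
    using l by simp_all
  moreover have "runner e (uglov e l Bs) next_runner
      = {p. p div int l * int e + int next_runner \<in> Bs (l - nat (p mod int l))}"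
    using e l by (intro runner_uglov) auto
  ultimately show ?thesis
    by (simp only: mem_Collect_eq next_position)
qed

text \<open>A component together with an integer of residue \<open>k\<close> is the same datum as
  one position on runner \<open>k\<close>, so counting component by component becomes counting on a
  single runner.\<close>

lemma sum_card_positions:
  fixes S :: "nat \<Rightarrow> int set"
  assumes fin: "\<And>j. j \<in> {1..l} \<Longrightarrow> finite (S j)"
    and S: "\<And>j z. j \<in> {1..l} \<Longrightarrow> z \<in> S j \<Longrightarrow> z mod int e = int k"
  shows "(\<Sum>j=1..l. card (S j))
    = card {p. p div int l * int e + int k \<in> S (l - nat (p mod int l))}"
proof -
  have z_eq: "z div int e * int e + int k = z" if "j \<in> {1..l}" "z \<in> S j" for j z
    using S[OF that] by (metis div_mult_mod_eq)
  have "bij_betw (\<lambda>p. (l - nat (p mod int l), p div int l * int e + int k))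
      {p. p div int l * int e + int k \<in> S (l - nat (p mod int l))} (SIGMA j:{1..l}. S j)"
  proof (rule bij_betwI[where g = "\<lambda>(j, z). z div int e * int l + int (l - j)"])
    show "(\<lambda>p. (l - nat (p mod int l), p div int l * int e + int k))
      \<in> {p. p div int l * int e + int k \<in> S (l - nat (p mod int l))} \<rightarrow> (SIGMA j:{1..l}. S j)"
      using component_index[of l] l by auto
    show "(\<lambda>(j, z). z div int e * int l + int (l - j)) \<in> (SIGMA j:{1..l}. S j)
      \<rightarrow> {p. p div int l * int e + int k \<in> S (l - nat (p mod int l))}"
      using z_eq by (auto simp: position_component simp del: of_nat_diff)
    fix p assume "p \<in> {p. p div int l * int e + int k \<in> S (l - nat (p mod int l))}"
    have "int (l - (l - nat (p mod int l))) = p mod int l"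
      using l by (intro component_index) simp
    moreover have "(p div int l * int e + int k) div int e = p div int l"
      using k by simp
    ultimately show "(\<lambda>(j, z). z div int e * int l + int (l - j))
        (l - nat (p mod int l), p div int l * int e + int k) = p"
      by (simp del: of_nat_diff)
  next
    fix y assume "y \<in> (SIGMA j:{1..l}. S j)"
    then obtain j z where "y = (j, z)" "j \<in> {1..l}" "z \<in> S j"
      by auto
    then show "(\<lambda>p. (l - nat (p mod int l), p div int l * int e + int k))
        ((\<lambda>(j, z). z div int e * int l + int (l - j)) y) = y"
      using z_eq[of j z] by (simp add: position_component del: of_nat_diff)
  qed
  from bij_betw_same_card[OF this] show ?thesis
    using fin by simp
qed

text \<open>The removable gaps of all components together form the shifted next runner minus runner
  \<open>k\<close>, the addable gaps the opposite difference. \<open>charge_Diff\<close> turns the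
  counts into charges, and the shift costs \<open>wrap\<close>.\<close>

lemma sum_gap_delta:
  assumes Bs: "\<And>j. j \<in> {1..l} \<Longrightarrow> beta_set (Bs j)"
  shows "(\<Sum>j=1..l. gap_delta e k (Bs j)) = charge (runner e (uglov e l Bs) next_runner) - wrap
    - charge (runner e (uglov e l Bs) k)"
proof -
  let ?R = "\<lambda>i. runner e (uglov e l Bs) i"
  have beta: "beta_set (?R k)" "beta_set (?R next_runner)"
    using e l k Bs by (auto intro!: beta_set_runner_uglov)
  have R_k: "?R k = {p. p div int l * int e + int k \<in> Bs (l - nat (p mod int l))}"
    using e l k by (intro runner_uglov) auto
  have mod: "(p div int l * int e + int k) mod int e = int k" for p
    using k by simp
  have "(\<Sum>j=1..l. card (removable_gaps e k (Bs j)))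
      = card {p. p div int l * int e + int k \<in> removable_gaps e k (Bs (l - nat (p mod int l)))}"
    using Bs by (intro sum_card_positions finite_gaps) (auto simp: removable_gaps_def)
  also have "{p. p div int l * int e + int k \<in> removable_gaps e k (Bs (l - nat (p mod int l)))}
      = {p. p + wrap \<in> ?R next_runner} - ?R k"
    unfolding runner_next unfolding R_k removable_gaps_def
    by (simp only: mem_Collect_eq set_diff_eq mod simp_thms)
  finally have "(\<Sum>j=1..l. card (removable_gaps e k (Bs j)))
      = card ({p. p + wrap \<in> ?R next_runner} - ?R k)" .
  moreover have "(\<Sum>j=1..l. card (addable_gaps e k (Bs j)))
      = card {p. p div int l * int e + int k \<in> addable_gaps e k (Bs (l - nat (p mod int l)))}"
    using Bs by (intro sum_card_positions finite_gaps) (auto simp: addable_gaps_def)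
  moreover have "{p. p div int l * int e + int k \<in> addable_gaps e k (Bs (l - nat (p mod int l)))}
      = ?R k - {p. p + wrap \<in> ?R next_runner}"
    unfolding runner_next unfolding R_k addable_gaps_def
    by (simp only: mem_Collect_eq set_diff_eq mod simp_thms)
  ultimately have "(\<Sum>j=1..l. gap_delta e k (Bs j))
      = charge {p. p + wrap \<in> ?R next_runner} - charge (?R k)"
    using charge_Diff[OF beta_set_translate[OF beta(2)] beta(1), of wrap]
    by (simp add: gap_delta_def sum_subtractf flip: of_nat_sum)
  then show ?thesis
    by (simp add: charge_translate[OF beta(2)])
qed

text \<open>Runner \<open>k\<close> loses one bead and the next runner gains one; no other runner
  changes. Each of the two changes of charge raises the sum of the \<open>gap_delta\<close> by one,
  whence the \<open>+ 2\<close>.\<close>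

lemma move_bead:
  assumes Bs: "\<And>j. j \<in> {1..l} \<Longrightarrow> beta_set (Bs j)"
    and m: "m \<in> {1..l}" and z: "z mod int e = int k" "z \<in> Bs m" "z + 1 \<notin> Bs m"
    and Bs': "Bs' m = insert (z + 1) (Bs m - {z})" "\<And>j. j \<in> {1..l} \<Longrightarrow> j \<noteq> m \<Longrightarrow> Bs' j = Bs j"
  shows "wt_beta e (uglov e l Bs')
      = wt_beta e (uglov e l Bs) - (\<Sum>j=1..l. gap_delta e k (Bs j)) - 1"
    and "(\<Sum>j=1..l. gap_delta e k (Bs' j)) = (\<Sum>j=1..l. gap_delta e k (Bs j)) + 2"
proof -
  let ?R = "\<lambda>i. runner e (uglov e l Bs) i" and ?R' = "\<lambda>i. runner e (uglov e l Bs') i"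
  \<comment> \<open>With \<open>e = 1\<close> the bead would return to the runner it left.\<close>
  have ne: "next_runner \<noteq> k"
    using e k by (cases "Suc k = e") auto
  have Bs'_beta: "beta_set (Bs' j)" if "j \<in> {1..l}" for j
  proof (cases "j = m")
    case True
    obtain c M where "{..<c} \<subseteq> Bs m" "Bs m \<subseteq> {..<M}"
      using Bs[OF m] by (auto simp: beta_set_def)
    then have "{..<min c z} \<subseteq> Bs m - {z}" "Bs m - {z} \<subseteq> {..<M}"
      by auto
    then have "beta_set (Bs m - {z})"
      unfolding beta_set_def by blast
    then show ?thesis
      unfolding True Bs' by (rule beta_set_insert)
  next
    case False
    then show ?thesis
      using Bs Bs' that by simp
  qed
  have beta: "beta_set (?R i)" "beta_set (?R' i)" if "i < e" for i
    using e l Bs Bs'_beta that by (auto intro!: beta_set_runner_uglov)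
  \<comment> \<open>The place on runner \<open>k\<close> of the bead \<open>z\<close> of component
    \<open>m\<close>; the moved bead will be at \<open>p + wrap\<close> on the next runner.\<close>
  define p where "p = z div int e * int l + int (l - m)"
  have pm: "p div int l = z div int e" "l - nat (p mod int l) = m"
    unfolding p_def using m by (simp_all only: position_component)
  have p_unique: "p' = p" if "p' div int l = z div int e" "l - nat (p' mod int l) = m" for p'
  proof -
    have "int (l - (l - nat (p' mod int l))) = p' mod int l"
      using l by (intro component_index) simp
    then show ?thesis
      unfolding p_def using that by (metis div_mult_mod_eq)
  qed
  have z_eq: "z div int e * int e + int k = z"
    using z(1) by (metis div_mult_mod_eq)
  have pos: "a * int e + int i = z \<longleftrightarrow> a = z div int e \<and> i = k" if "i < e" for a i
  proof
    assume "a * int e + int i = z"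
    moreover have "(a * int e + int i) div int e = a" "(a * int e + int i) mod int e = int i"
      using that by auto
    ultimately show "a = z div int e \<and> i = k"
      using z(1) by auto
  qed (use z_eq in auto)
  have next_pos: "a * int e + int i = z + 1
      \<longleftrightarrow> a = z div int e + int (Suc k div e) \<and> i = next_runner" if "i < e" for a i
  proof
    have eq: "(z div int e + int (Suc k div e)) * int e + int next_runner = z + 1"
      using next_position[of p] z_eq unfolding pm by linarith
    show "a * int e + int i = z + 1"
      if "a = z div int e + int (Suc k div e) \<and> i = next_runner"
      using that eq by simp
    assume "a * int e + int i = z + 1"
    then have *: "a * int e + int i = (z div int e + int (Suc k div e)) * int e + int next_runner"
      using eq by simp
    have "(a * int e + int i) div int e = a" "(a * int e + int i) mod int e = int i"
      using that by auto
    moreover have "(b * int e + int next_runner) div int e = b"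
        "(b * int e + int next_runner) mod int e = int next_runner" for b
      using e by (simp_all add: zmod_int del: of_nat_Suc)
    ultimately show "a = z div int e + int (Suc k div e) \<and> i = next_runner"
      using * by (metis of_nat_eq_iff)
  qed
  have mem: "p' \<in> ?R' i \<longleftrightarrow>
      (if l - nat (p' mod int l) = m
       then p' div int l * int e + int i = z + 1
         \<or> p' \<in> ?R i \<and> p' div int l * int e + int i \<noteq> z
       else p' \<in> ?R i)" if "i < e" for p' i
    using e l that Bs' component_index[of l p'] by (auto simp: runner_uglov)
  have p_next: "(p + wrap) div int l = z div int e + int (Suc k div e)"
      "l - nat ((p + wrap) mod int l) = m"
    using l pm by simp_all
  have p_next_unique: "p' = p + wrap"
    if "p' div int l = z div int e + int (Suc k div e)" "l - nat (p' mod int l) = m" for p'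
  proof -
    have "((p' - wrap) + wrap) div int l = (p' - wrap) div int l + int (Suc k div e)"
      "((p' - wrap) + wrap) mod int l = (p' - wrap) mod int l"
      using l by (simp_all only: div_mult_self1 mod_mult_self1)
    then have "(p' - wrap) div int l = z div int e" "(p' - wrap) mod int l = p' mod int l"
      using that(1) by simp_all
    then show ?thesis
      using p_unique[of "p' - wrap"] that by simp
  qed
  have other: "?R' i = ?R i" if "i < e" "i \<noteq> k" "i \<noteq> next_runner" for i
    using that by (auto simp only: mem pos next_pos split: if_splits)
  have from_k: "?R k = insert p (?R' k)" "p \<notin> ?R' k"
  proof -
    have "p \<in> ?R k"
      using e l k z z_eq by (simp add: runner_uglov pm)
    then show "?R k = insert p (?R' k)" "p \<notin> ?R' k"
      using k ne p_unique by (auto simp: mem pos next_pos pm split: if_splits)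
  qed
  have to_next: "?R' next_runner = insert (p + wrap) (?R next_runner)"
    "p + wrap \<notin> ?R next_runner"
  proof -
    have lt: "next_runner < e"
      using e by simp
    show "?R' next_runner = insert (p + wrap) (?R next_runner)"
    proof (intro Set.set_eqI)
      fix p'
      show "p' \<in> ?R' next_runner \<longleftrightarrow> p' \<in> insert (p + wrap) (?R next_runner)"
        using p_next p_next_unique[of p'] ne
        by (auto simp only: mem[OF lt] pos[OF lt] next_pos[OF lt] insert_iff split: if_splits)
    qed
    show "p + wrap \<notin> ?R next_runner"
      using z(3) unfolding runner_next pm z_eq .
  qed
  have charges: "charge (?R k) = charge (?R' k) + 1"
      "charge (?R' next_runner) = charge (?R next_runner) + 1"
    using charge_insert[OF beta(2)[OF k] from_k(2)]
      charge_insert[OF beta(1) to_next(2)] from_k(1) to_next(1) e by simp_all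
  then show "(\<Sum>j=1..l. gap_delta e k (Bs' j)) = (\<Sum>j=1..l. gap_delta e k (Bs j)) + 2"
    using sum_gap_delta[OF Bs] sum_gap_delta[OF Bs'_beta] by simp
  have split: "(\<Sum>i<e. f i) = f k + f next_runner + (\<Sum>i\<in>{..<e} - {k, next_runner}. f i)"
    for f :: "nat \<Rightarrow> int"
    using e k ne by (subst sum.subset_diff[of "{k, next_runner}"]) auto
  \<comment> \<open>Runner \<open>k\<close> is measured after the bead has left and the next one
    before it arrives. The charge of \<open>?R' k\<close> is one below that of \<open>?R k\<close>,
    which produces the final \<open>- 1\<close>.\<close>
  have "beta_size (?R k) = beta_size (?R' k) + p - charge (?R' k)"
    using beta_size_insert[OF beta(2)[OF k] from_k(2)] from_k(1) by simp
  moreover have "beta_size (?R' next_runner)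
      = beta_size (?R next_runner) + (p + wrap) - charge (?R next_runner)"
    using beta_size_insert[OF beta(1) to_next(2)] to_next(1) e by simp
  moreover have "(\<Sum>i\<in>{..<e} - {k, next_runner}. beta_size (?R' i))
      = (\<Sum>i\<in>{..<e} - {k, next_runner}. beta_size (?R i))"
    using other by (intro sum.cong) auto
  ultimately show "wt_beta e (uglov e l Bs')
      = wt_beta e (uglov e l Bs) - (\<Sum>j=1..l. gap_delta e k (Bs j)) - 1"
    unfolding wt_beta_eq split using charges sum_gap_delta[OF Bs] by simp
qed

end

section \<open>Nodes and beads\<close>

lemma partition_antimono:
  assumes "p \<in> partitions" "1 \<le> a" "a \<le> b"
  shows "p b \<le> p a"
  using assms(3)
proof (induction b rule: dec_induct)
  case (step b)
  then have "p (Suc b) \<le> p b"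
    using assms by (simp add: partitions_def)
  then show ?case
    using step by simp
qed simp

lemma bead_less:
  assumes "p \<in> partitions" "1 \<le> a" "a < b"
  shows "int (p b) + t - int b < int (p a) + t - int a"
  using partition_antimono[OF assms(1,2), of b] assms(3) by simp

lemma bead_eq_iff:
  assumes "p \<in> partitions" "1 \<le> a" "1 \<le> b"
  shows "int (p a) + t - int a = int (p b) + t - int b \<longleftrightarrow> a = b"
  using bead_less[OF assms(1,2), of b t] bead_less[OF assms(1,3), of a t]
  by (cases a b rule: linorder_cases) auto

lemma beta_set_beta:
  assumes "p \<in> partitions"
  shows "beta_set (beta t p)"
proof -
  have "finite {a. p a \<noteq> 0}"
    using assms by (simp add: partitions_def)
  then obtain N where N: "\<And>a. p a \<noteq> 0 \<Longrightarrow> a \<le> N"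
    using finite_nat_set_iff_bounded_le by auto
  show ?thesis
  proof (rule beta_setI)
    fix x assume x: "x < t - int N"
    define a where "a = nat (t - x)"
    have "N < a" "int a = t - x" "1 \<le> a"
      using x by (simp_all add: a_def)
    moreover from this have "p a = 0"
      using N[of a] by (meson not_less)
    ultimately show "x \<in> beta t p"
      unfolding beta_def by (intro CollectI exI[of _ a]) simp
  next
    fix x assume "x \<in> beta t p"
    then obtain a where "1 \<le> a" "x = int (p a) + t - int a"
      by (auto simp: beta_def)
    then show "x < int (p 1) + t"
      using partition_antimono[OF assms, of 1 a] by simp
  qed
qed

lemma beta_translate: "beta (t + c) p = {x. x - c \<in> beta t p}"
proof (intro Set.set_eqI)
  fix x
  have "x = int (p a) + (t + c) - int a \<longleftrightarrow> x - c = int (p a) + t - int a" for a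
    by linarith
  then show "x \<in> beta (t + c) p \<longleftrightarrow> x \<in> {x. x - c \<in> beta t p}"
    unfolding beta_def by simp
qed

lemma bead_in_beta: "1 \<le> a \<Longrightarrow> int (p a) + t - int a \<in> beta t p"
  unfolding beta_def by (intro CollectI exI[of _ a]) simp

lemma partition_pred:
  assumes "p \<in> partitions" "1 \<le> a"
  shows "a = 1 \<or> p a \<le> p (a - 1)"
proof (cases "a = 1")
  case False
  then have "1 \<le> a - 1"
    using assms(2) by simp
  then show ?thesis
    using partition_antimono[OF assms(1), of "a - 1" a] by simp
qed simp

text \<open>Beads strictly decrease with the row, so only bead \<open>a + 1\<close> can sit directly
  below bead \<open>a\<close>, and it does so exactly when the two parts are equal.\<close>

lemma bead_pred:
  assumes p: "p \<in> partitions" and a: "1 \<le> a"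
  shows "int (p a) + t - int a - 1 \<notin> beta t p \<longleftrightarrow> p (Suc a) < p a"
proof
  assume "int (p a) + t - int a - 1 \<notin> beta t p"
  then have "int (p (Suc a)) + t - int (Suc a) \<noteq> int (p a) + t - int a - 1"
    using bead_in_beta[of "Suc a" p t] by (metis le_SucI a)
  then show "p (Suc a) < p a"
    using partition_antimono[OF p a, of "Suc a"] by simp
next
  assume less: "p (Suc a) < p a"
  show "int (p a) + t - int a - 1 \<notin> beta t p"
  proof
    assume "int (p a) + t - int a - 1 \<in> beta t p"
    then obtain b where b: "1 \<le> b" "int (p a) + t - int a - 1 = int (p b) + t - int b"
      by (auto simp: beta_def)
    then consider "b \<le> a" | "b = Suc a" | "Suc a < b"
      by linarith
    then show False
    proof cases
      case 1
      then show ?thesis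
        using partition_antimono[OF p b(1)] b(2) by force
    next
      case 2
      then show ?thesis
        using b(2) less by simp
    next
      case 3
      then show ?thesis
        using bead_less[OF p _ 3, of t] b(2) less by simp
    qed
  qed
qed

text \<open>Only bead \<open>a - 1\<close> can sit directly above bead \<open>a\<close>; the first
  row has no bead above it, whence the separate case.\<close>

lemma bead_succ:
  assumes p: "p \<in> partitions" and a: "1 \<le> a"
  shows "int (p a) + t - int a + 1 \<notin> beta t p \<longleftrightarrow> a = 1 \<or> p a < p (a - 1)"
proof
  assume *: "int (p a) + t - int a + 1 \<notin> beta t p"
  show "a = 1 \<or> p a < p (a - 1)"
  proof (cases "a = 1")
    case False
    then have a1: "1 \<le> a - 1" "int (a - 1) = int a - 1"
      using a by auto
    then have "int (p (a - 1)) + t - int (a - 1) \<noteq> int (p a) + t - int a + 1"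
      using * bead_in_beta[OF a1(1), of p t] by metis
    then show ?thesis
      using partition_antimono[OF p a1(1), of a] a1(2) by force
  qed simp
next
  assume less: "a = 1 \<or> p a < p (a - 1)"
  show "int (p a) + t - int a + 1 \<notin> beta t p"
  proof
    assume "int (p a) + t - int a + 1 \<in> beta t p"
    then obtain b where b: "1 \<le> b" "int (p a) + t - int a + 1 = int (p b) + t - int b"
      by (auto simp: beta_def)
    then have "b < a"
      using partition_antimono[OF p a, of b] by (cases "b < a") auto
    then have a1: "1 \<le> a - 1" "int (a - 1) = int a - 1" "b \<le> a - 1" "p a < p (a - 1)"
      using b(1) less by auto
    then have "p (a - 1) \<le> p b"
      using partition_antimono[OF p b(1)] by blast
    then show False
      using a1 b(2) by linarith
  qed
qed

text \<open>The beads of the other rows, collected in \<open>D\<close>, are common to both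
  partitions; row \<open>a\<close> contributes \<open>z\<close> to the smaller one and
  \<open>z + 1\<close> to the larger one.\<close>

lemma beta_remove_node:
  assumes p: "p \<in> partitions" and p': "p' \<in> partitions" and a: "1 \<le> a" and b: "1 \<le> p a"
    and upd: "p' = p(a := p a - 1)" and z: "z = int (p a) - int a + t - 1"
  shows "beta t p = insert (z + 1) (beta t p' - {z})" "z \<in> beta t p'" "z + 1 \<notin> beta t p'"
proof -
  define D where "D = (\<lambda>c. int (p c) + t - int c) ` ({1..} - {a})"
  have image: "beta t p = (\<lambda>c. int (p c) + t - int c) ` {1..}" for p
    unfolding beta_def by auto
  have from1: "{1..} = insert a ({1..} - {a})"
    using a by auto
  have z': "z = int (p' a) + t - int a" "z + 1 = int (p a) + t - int a"
    using b by (simp_all add: z upd)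
  have 1: "beta t p = insert (z + 1) D"
    unfolding image D_def z'(2) by (subst from1) (rule image_insert)
  have D: "D = (\<lambda>c. int (p' c) + t - int c) ` ({1..} - {a})"
    unfolding D_def upd by (intro image_cong) auto
  have 2: "beta t p' = insert z D"
    unfolding image D z'(1) by (subst from1) (rule image_insert)
  have 3: "z \<notin> D"
    unfolding z'(1) D using bead_eq_iff[OF p' a, of _ t] by auto
  have 4: "z + 1 \<notin> D"
    unfolding z'(2) D_def using bead_eq_iff[OF p a, of _ t] by auto
  show "beta t p = insert (z + 1) (beta t p' - {z})" "z \<in> beta t p'" "z + 1 \<notin> beta t p'"
    using 1 2 3 4 by auto
qed

section \<open>Diagrams that differ by one node\<close>

lemma multipartition_component:
  assumes "lam \<in> multipartitions l" "j \<in> {1..l}"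
  shows "lam j \<in> partitions"
  using assms by (simp add: multipartitions_def)

lemma multipartitions_update:
  assumes lam: "lam \<in> multipartitions l" and "j \<in> {1..l}" and p: "p \<in> partitions"
  shows "lam(j := p) \<in> multipartitions l"
  using assms by (auto simp: multipartitions_def)

lemma partitions_update:
  assumes p: "p \<in> partitions" and a: "1 \<le> a"
    and "p (Suc a) \<le> b" "a = 1 \<or> b \<le> p (a - 1)"
  shows "p(a := b) \<in> partitions"
proof -
  have "{c. (p(a := b)) c \<noteq> 0} \<subseteq> insert a {c. p c \<noteq> 0}"
    by auto
  then have "finite {c. (p(a := b)) c \<noteq> 0}"
    by (rule finite_subset) (use p in \<open>simp add: partitions_def\<close>)
  moreover have "(p(a := b)) (Suc c) \<le> (p(a := b)) c" if "1 \<le> c" for c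
    using assms that by (auto simp: partitions_def)
  ultimately show ?thesis
    using p a by (simp add: partitions_def)
qed

lemma remove_node:
  assumes lam: "lam \<in> multipartitions l" and j: "j \<in> {1..l}" and a: "1 \<le> a"
    and less: "lam j (Suc a) < lam j a"
  shows "(a, lam j a, j) \<in> young l lam"
    and "lam(j := (lam j)(a := lam j a - 1)) \<in> multipartitions l"
    and "young l (lam(j := (lam j)(a := lam j a - 1))) = young l lam - {(a, lam j a, j)}"
proof -
  show "(a, lam j a, j) \<in> young l lam"
    using j a less by (simp add: young_def)
  have p: "lam j \<in> partitions"
    by (rule multipartition_component[OF lam j])
  have "a = 1 \<or> lam j a \<le> lam j (a - 1)"
    by (rule partition_pred[OF p a])
  then show "lam(j := (lam j)(a := lam j a - 1)) \<in> multipartitions l"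
    using less by (intro multipartitions_update[OF lam j] partitions_update[OF p a]) auto
  show "young l (lam(j := (lam j)(a := lam j a - 1))) = young l lam - {(a, lam j a, j)}"
    by (auto simp: young_def split: if_splits)
qed

text \<open>Rows of a diagram are initial segments, so a node whose removal leaves a diagram must
  end its row. This translates the definitions of removable and addable nodes, which speak of
  diagrams, into an equation between functions.\<close>

lemma young_Diff_node:
  assumes lam: "lam \<in> multipartitions l" and mu: "mu \<in> multipartitions l"
    and x: "(a, b, j) \<in> young l lam" and y: "young l mu = young l lam - {(a, b, j)}"
  shows "1 \<le> a" "j \<in> {1..l}" "1 \<le> b" "lam j a = b" "mu = lam(j := (lam j)(a := b - 1))"
proof -
  show ab: "1 \<le> a" "j \<in> {1..l}" "1 \<le> b"
    using x by (auto simp: young_def)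
  have le: "d \<le> mu m c \<longleftrightarrow> d \<le> lam m c \<and> (c, d, m) \<noteq> (a, b, j)"
    if "1 \<le> c" "1 \<le> d" "m \<in> {1..l}" for c d m
  proof -
    have "(c, d, m) \<in> young l mu \<longleftrightarrow> (c, d, m) \<in> young l lam \<and> (c, d, m) \<noteq> (a, b, j)"
      using y by blast
    then show ?thesis
      using that by (simp add: young_def)
  qed
  have ge: "b \<le> lam j a" and not: "\<not> b \<le> mu j a"
    using x le[OF ab(1,3,2)] by (auto simp: young_def)
  then show lam_b: "lam j a = b"
    using le[OF ab(1) _ ab(2), of "Suc b"] by (cases "b = lam j a") auto
  have "mu m c = (lam(j := (lam j)(a := b - 1))) m c" for m c
  proof (cases "m \<in> {1..l} \<and> 1 \<le> c")
    case True
    show ?thesis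
    proof (cases "m = j \<and> c = a")
      case True
      have "b - 1 \<le> mu j a"
        using le[OF ab(1) _ ab(2), of "b - 1"] lam_b ab(3) by (cases "b = 1") auto
      then show ?thesis
        using True not by simp
    next
      case False
      have "d \<le> mu m c \<longleftrightarrow> d \<le> lam m c" if "1 \<le> d" for d
        using le[of c d m] that True False by auto
      then have "mu m c = lam m c"
        by (metis Suc_le_eq le_antisym less_one linorder_not_less nle_le)
      then show ?thesis
        using False by auto
    qed
  next
    case False
    \<comment> \<open>At row index 0 and outside the components \<open>{1..l}\<close>, where the
      diagram gives no information, both functions have the default value 0.\<close>
    then have "mu m c = 0 \<and> lam m c = 0"
      using lam mu unfolding multipartitions_def partitions_def
      by (cases "m \<in> {1..l}") (auto simp: not_le)
    then show ?thesis
      using False ab by auto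
  qed
  then show "mu = lam(j := (lam j)(a := b - 1))"
    by blast
qed

lemma removable_iff:
  assumes lam: "lam \<in> multipartitions l"
  shows "(a, b, j) \<in> removable e l r i lam \<longleftrightarrow> 1 \<le> a \<and> j \<in> {1..l} \<and> b = lam j a
    \<and> lam j (Suc a) < lam j a \<and> (int b - int a + r j) mod int e = i"
proof
  assume x: "(a, b, j) \<in> removable e l r i lam"
  then obtain mu where mu: "mu \<in> multipartitions l" "young l mu = young l lam - {(a, b, j)}"
    and y: "(a, b, j) \<in> young l lam"
    by (auto simp: removable_def)
  note node = young_Diff_node[OF lam mu(1) y mu(2)]
  have "mu j (Suc a) \<le> mu j a"
    using multipartition_component[OF mu(1) node(2)] node(1) by (simp add: partitions_def)
  then have "lam j (Suc a) < lam j a"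
    using node(3,4) unfolding node(5) by simp
  then show "1 \<le> a \<and> j \<in> {1..l} \<and> b = lam j a \<and> lam j (Suc a) < lam j a
      \<and> (int b - int a + r j) mod int e = i"
    using node x by (auto simp: removable_def residue_def)
next
  assume *: "1 \<le> a \<and> j \<in> {1..l} \<and> b = lam j a \<and> lam j (Suc a) < lam j a
      \<and> (int b - int a + r j) mod int e = i"
  then have ja: "j \<in> {1..l}" "1 \<le> a" "lam j (Suc a) < lam j a" and b: "b = lam j a"
    by blast+
  have "residue e r (a, b, j) = i"
    using * unfolding residue_def prod.case by blast
  then show "(a, b, j) \<in> removable e l r i lam"
    using remove_node[OF lam ja] unfolding removable_def b by blast
qed

lemma addable_iff:
  assumes mu: "mu \<in> multipartitions l"
  shows "(a, b, j) \<in> addable e l r i mu \<longleftrightarrow> 1 \<le> a \<and> j \<in> {1..l} \<and> b = mu j a + 1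
    \<and> (a = 1 \<or> mu j a < mu j (a - 1)) \<and> (int b - int a + r j) mod int e = i"
proof
  assume "(a, b, j) \<in> addable e l r i mu"
  then obtain lam where lam: "lam \<in> multipartitions l" "(a, b, j) \<in> removable e l r i lam"
    "young l mu = young l lam - {(a, b, j)}"
    by (auto simp: addable_def)
  then have "(a, b, j) \<in> young l lam"
    by (simp add: removable_def)
  note node = young_Diff_node[OF lam(1) mu this lam(3)]
  have "a = 1 \<or> lam j a \<le> lam j (a - 1)"
    by (rule partition_pred[OF multipartition_component[OF lam(1) node(2)] node(1)])
  then have "a = 1 \<or> mu j a < mu j (a - 1)"
    using node(1,3,4) unfolding node(5) by auto
  moreover have "b = mu j a + 1"
    using node(3) unfolding node(5) by simp
  ultimately show "1 \<le> a \<and> j \<in> {1..l} \<and> b = mu j a + 1 \<and> (a = 1 \<or> mu j a < mu j (a - 1))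
      \<and> (int b - int a + r j) mod int e = i"
    using lam(2) removable_iff[OF lam(1)] by blast
next
  assume *: "1 \<le> a \<and> j \<in> {1..l} \<and> b = mu j a + 1 \<and> (a = 1 \<or> mu j a < mu j (a - 1))
      \<and> (int b - int a + r j) mod int e = i"
  define lam where "lam = mu(j := (mu j)(a := b))"
  have p: "mu j \<in> partitions"
    using multipartition_component[OF mu] * by blast
  have le: "mu j (Suc a) \<le> mu j a"
    using partition_antimono[OF p, of a "Suc a"] * by simp
  have ja: "1 \<le> a" "j \<in> {1..l}" "mu j (Suc a) \<le> b" "a = 1 \<or> b \<le> mu j (a - 1)"
    using * le by auto
  have "(mu j)(a := b) \<in> partitions"
    by (rule partitions_update[OF p ja(1,3,4)])
  then have lam: "lam \<in> multipartitions l"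
    unfolding lam_def by (rule multipartitions_update[OF mu ja(2)])
  have b: "lam j a = b" "lam j (Suc a) < lam j a" "lam(j := (lam j)(a := lam j a - 1)) = mu"
    using * le by (auto simp: lam_def)
  then have "young l mu = young l lam - {(a, b, j)}"
    using remove_node(3)[OF lam ja(2,1)] by metis
  moreover have "(a, b, j) \<in> removable e l r i lam"
    unfolding removable_iff[OF lam] b(1) using * b(2)[unfolded b(1)] by blast
  ultimately show "(a, b, j) \<in> addable e l r i mu"
    unfolding addable_def using lam by blast
qed

lemma mod_succ_eq_iff:
  assumes "k < e"
  shows "(z + 1) mod int e = int (Suc k mod e) \<longleftrightarrow> z mod int e = int k"
proof
  assume "(z + 1) mod int e = int (Suc k mod e)"
  then have "(z + 1) mod int e = (int k + 1) mod int e"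
    by (simp add: zmod_int add.commute)
  then have "(z + 1 - 1) mod int e = (int k + 1 - 1) mod int e"
    by (rule mod_diff_cong) simp
  then show "z mod int e = int k"
    using assms by simp
next
  assume "z mod int e = int k"
  then have "(z + 1) mod int e = (int k + 1) mod int e"
    by (metis mod_add_left_eq)
  then show "(z + 1) mod int e = int (Suc k mod e)"
    by (simp add: zmod_int add.commute)
qed

text \<open>\<open>?bead\<close> sends a node to its component and the lower of the two positions
  between which its bead moves. Contents alone do not separate nodes, but a removable or addable
  node is determined by its component and row, and distinct rows of a component have distinct
  beads.\<close>

lemma delta_eq_gap_delta:
  assumes lam: "lam \<in> multipartitions l" and k: "k < e"
  shows "delta e l r (int (Suc k mod e)) lam = (\<Sum>j=1..l. gap_delta e k (beta (r j) (lam j)))"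
proof -
  let ?i = "int (Suc k mod e)" and ?B = "\<lambda>j. beta (r j) (lam j)"
  let ?bead = "\<lambda>(a :: nat, b :: nat, j). (j, int b - int a + r j - 1)"
  have part: "lam j \<in> partitions" if "j \<in> {1..l}" for j
    by (rule multipartition_component[OF lam that])
  have res: "(int b - int a + r j) mod int e = ?i \<longleftrightarrow> (int b - int a + r j - 1) mod int e = int k"
    for a b j
    using mod_succ_eq_iff[OF k, of "int b - int a + r j - 1"] by simp
  have "bij_betw ?bead (removable e l r ?i lam) (SIGMA j:{1..l}. removable_gaps e k (?B j))"
  proof (rule bij_betw_imageI)
    show "inj_on ?bead (removable e l r ?i lam)"
    proof (rule inj_onI)
      fix x y assume x: "x \<in> removable e l r ?i lam" and y: "y \<in> removable e l r ?i lam"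
        and eq: "?bead x = ?bead y"
      obtain a b j a' b' j' where xy: "x = (a, b, j)" "y = (a', b', j')"
        by (metis prod_cases3)
      have j: "j' = j" and "int b - int a = int b' - int a'"
        using eq unfolding xy by auto
      moreover have *: "1 \<le> a" "1 \<le> a'" "j \<in> {1..l}" "b = lam j a" "b' = lam j a'"
        using x y unfolding xy removable_iff[OF lam] j by blast+
      ultimately have "int (lam j a) + r j - int a = int (lam j a') + r j - int a'"
        by simp
      then show "x = y"
        unfolding xy using bead_eq_iff[OF part[OF *(3)] *(1,2)] *(4,5) j by simp
    qed
    show "?bead ` removable e l r ?i lam = (SIGMA j:{1..l}. removable_gaps e k (?B j))"
    proof (intro subset_antisym subsetI)
      fix y assume "y \<in> ?bead ` removable e l r ?i lam"
      then obtain a b j where x: "(a, b, j) \<in> removable e l r ?i lam"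
        and y: "y = (j, int b - int a + r j - 1)"
        by auto
      have *: "1 \<le> a" "j \<in> {1..l}" "b = lam j a" "lam j (Suc a) < lam j a"
        "(int b - int a + r j - 1) mod int e = int k"
        using x removable_iff[OF lam] res by blast+
      have "int b - int a + r j - 1 + 1 \<in> ?B j"
        unfolding beta_def using * by (intro CollectI exI[of _ a]) simp
      moreover have "int b - int a + r j - 1 \<notin> ?B j"
        using bead_pred[OF part[OF *(2)] *(1), of "r j"] * by (simp add: algebra_simps)
      ultimately show "y \<in> (SIGMA j:{1..l}. removable_gaps e k (?B j))"
        unfolding y removable_gaps_def using * by blast
    next
      fix y assume "y \<in> (SIGMA j:{1..l}. removable_gaps e k (?B j))"
      then obtain j z where y: "y = (j, z)" "j \<in> {1..l}"
        and z: "z mod int e = int k" "z + 1 \<in> ?B j" "z \<notin> ?B j"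
        by (auto simp: removable_gaps_def)
      obtain a where a: "1 \<le> a" "z + 1 = int (lam j a) + r j - int a"
        using z(2) by (auto simp: beta_def)
      then have z_eq: "z = int (lam j a) - int a + r j - 1" "z = int (lam j a) + r j - int a - 1"
        by linarith+
      have "(a, lam j a, j) \<in> removable e l r ?i lam"
        using a(1) y(2) z(1,3) bead_pred[OF part[OF y(2)] a(1), of "r j"] res[of "lam j a" a j]
          z_eq removable_iff[OF lam] by metis
      then show "y \<in> ?bead ` removable e l r ?i lam"
        unfolding y(1) by (intro image_eqI[of _ _ "(a, lam j a, j)"]) (simp_all add: z_eq(1))
    qed
  qed
  from bij_betw_same_card[OF this]
  have removable: "card (removable e l r ?i lam) = (\<Sum>j=1..l. card (removable_gaps e k (?B j)))"
    using part by (simp add: finite_gaps beta_set_beta)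
  have "bij_betw ?bead (addable e l r ?i lam) (SIGMA j:{1..l}. addable_gaps e k (?B j))"
  proof (rule bij_betw_imageI)
    show "inj_on ?bead (addable e l r ?i lam)"
    proof (rule inj_onI)
      fix x y assume x: "x \<in> addable e l r ?i lam" and y: "y \<in> addable e l r ?i lam"
        and eq: "?bead x = ?bead y"
      obtain a b j a' b' j' where xy: "x = (a, b, j)" "y = (a', b', j')"
        by (metis prod_cases3)
      have j: "j' = j" and "int b - int a = int b' - int a'"
        using eq unfolding xy by auto
      moreover have *: "1 \<le> a" "1 \<le> a'" "j \<in> {1..l}" "b = lam j a + 1" "b' = lam j a' + 1"
        using x y unfolding xy addable_iff[OF lam] j by blast+
      ultimately have "int (lam j a) + r j - int a = int (lam j a') + r j - int a'"
        by simp
      then show "x = y"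
        unfolding xy using bead_eq_iff[OF part[OF *(3)] *(1,2)] *(4,5) j by simp
    qed
    show "?bead ` addable e l r ?i lam = (SIGMA j:{1..l}. addable_gaps e k (?B j))"
    proof (intro subset_antisym subsetI)
      fix y assume "y \<in> ?bead ` addable e l r ?i lam"
      then obtain a b j where x: "(a, b, j) \<in> addable e l r ?i lam"
        and y: "y = (j, int b - int a + r j - 1)"
        by auto
      have *: "1 \<le> a" "j \<in> {1..l}" "b = lam j a + 1" "a = 1 \<or> lam j a < lam j (a - 1)"
        "(int b - int a + r j - 1) mod int e = int k"
        using x addable_iff[OF lam] res by blast+
      have "int b - int a + r j - 1 \<in> ?B j"
        unfolding beta_def using * by (intro CollectI exI[of _ a]) simp
      moreover have "int b - int a + r j - 1 + 1 \<notin> ?B j"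
        using bead_succ[OF part[OF *(2)] *(1), of "r j"] * by (simp add: algebra_simps)
      ultimately show "y \<in> (SIGMA j:{1..l}. addable_gaps e k (?B j))"
        unfolding y addable_gaps_def using * by blast
    next
      fix y assume "y \<in> (SIGMA j:{1..l}. addable_gaps e k (?B j))"
      then obtain j z where y: "y = (j, z)" "j \<in> {1..l}"
        and z: "z mod int e = int k" "z \<in> ?B j" "z + 1 \<notin> ?B j"
        by (auto simp: addable_gaps_def)
      obtain a where a: "1 \<le> a" "z = int (lam j a) + r j - int a"
        using z(2) by (auto simp: beta_def)
      then have z_eq: "z = int (lam j a + 1) - int a + r j - 1"
        by simp
      have "(a, lam j a + 1, j) \<in> addable e l r ?i lam"
        using a y(2) z(1,3) bead_succ[OF part[OF y(2)] a(1), of "r j"]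
          res[of "lam j a + 1" a j] z_eq addable_iff[OF lam] by metis
      then show "y \<in> ?bead ` addable e l r ?i lam"
        unfolding y(1) by (intro image_eqI[of _ _ "(a, lam j a + 1, j)"]) (simp_all add: z_eq)
    qed
  qed
  from bij_betw_same_card[OF this]
  have "card (addable e l r ?i lam) = (\<Sum>j=1..l. card (addable_gaps e k (?B j)))"
    using part by (simp add: finite_gaps beta_set_beta)
  with removable show ?thesis
    by (simp add: delta_def gap_delta_def sum_subtractf)
qed

section \<open>Weights of multipartitions\<close>

text \<open>The weight at one element of the orbit. Keeping \<open>\<sigma>\<close> and
  \<open>u\<close> as parameters lets the same group element act on a multipartition and on its
  neighbour.\<close>

definition twisted_wt ::
  "nat \<Rightarrow> nat \<Rightarrow> (nat \<Rightarrow> int) \<Rightarrow> (nat \<Rightarrow> nat) \<Rightarrow> (nat \<Rightarrow> int) \<Rightarrow> (nat \<Rightarrow> nat \<Rightarrow> nat) \<Rightarrow> int" where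
  "twisted_wt e l r \<sigma> u lam = wt_multi e l (\<lambda>j. lam (\<sigma> j)) (\<lambda>j. r (\<sigma> j) + int e * u j)"

lemma beta_set_twisted:
  assumes "lam \<in> multipartitions l" "\<sigma> permutes {1..l}" "j \<in> {1..l}"
  shows "beta_set (beta t (lam (\<sigma> j)))"
proof -
  have "\<sigma> j \<in> {1..l}"
    using permutes_in_image[OF assms(2)] assms(3) by blast
  then show ?thesis
    by (rule beta_set_beta[OF multipartition_component[OF assms(1)]])
qed

lemma twisted_wt_nonneg:
  assumes "0 < e" "0 < l" "lam \<in> multipartitions l" "\<sigma> permutes {1..l}"
  shows "0 \<le> twisted_wt e l r \<sigma> u lam"
  unfolding twisted_wt_def wt_multi_def wt_beta_eq
proof (rule sum_nonneg)
  fix i assume "i \<in> {..<e}"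
  then have "i < e"
    by simp
  show "0 \<le> beta_size (runner e
      (uglov e l (\<lambda>j. beta (r (\<sigma> j) + int e * u j) (lam (\<sigma> j)))) i)"
    by (rule beta_size_nonneg, rule beta_set_runner_uglov[OF assms(1,2) \<open>i < e\<close>],
        rule beta_set_twisted[OF assms(3,4)])
qed

text \<open>\<open>LEAST\<close> over the integers is meaningful only if a minimum exists.
  Nonnegativity provides one by passing to \<open>nat\<close>, which loses nothing on these
  values.\<close>

lemma wt_hecke_attained:
  assumes "0 < e" "0 < l" "lam \<in> multipartitions l"
  obtains \<sigma> u where "\<sigma> permutes {1..l}" "wt_hecke e l r lam = twisted_wt e l r \<sigma> u lam"
proof -
  let ?P = "\<lambda>(\<sigma>, u :: nat \<Rightarrow> int). \<sigma> permutes {1..l}"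
    and ?f = "\<lambda>(\<sigma>, u). nat (twisted_wt e l r \<sigma> u lam)"
  have "?P (id, \<lambda>_. 0)"
    by (simp add: permutes_id)
  then obtain x where x: "?P x" "\<forall>y. ?P y \<longrightarrow> ?f x \<le> ?f y"
    using ex_has_least_nat[of ?P _ ?f] by blast
  obtain \<sigma> u where su: "x = (\<sigma>, u)"
    by fastforce
  have perm: "\<sigma> permutes {1..l}"
    using x(1) su by simp
  have "wt_hecke e l r lam = twisted_wt e l r \<sigma> u lam"
    unfolding wt_hecke_def
  proof (rule Least_equality)
    show "\<exists>(\<nu>, v)\<in>weyl_orbit e l r lam. twisted_wt e l r \<sigma> u lam = wt_multi e l \<nu> v"
      using perm unfolding weyl_orbit_def twisted_wt_def by blast
    fix w assume "\<exists>(\<nu>, v)\<in>weyl_orbit e l r lam. w = wt_multi e l \<nu> v"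
    then obtain \<sigma>' u' where w: "\<sigma>' permutes {1..l}" "w = twisted_wt e l r \<sigma>' u' lam"
      by (auto simp: weyl_orbit_def twisted_wt_def)
    then have "nat (twisted_wt e l r \<sigma> u lam) \<le> nat w"
      using x(2) su by auto
    then show "twisted_wt e l r \<sigma> u lam \<le> w"
      using twisted_wt_nonneg[OF assms w(1), of r u'] w(2) by simp
  qed
  with perm show thesis
    by (rule that)
qed

lemma twisted_wt_remove_node:
  assumes e: "2 \<le> e" and l: "1 \<le> l" and k: "k < e" and perm: "\<sigma> permutes {1..l}"
    and lam: "lam \<in> multipartitions l" and mu: "mu \<in> multipartitions l"
    and x: "x \<in> removable e l r (int (Suc k mod e)) lam" and y: "young l mu = young l lam - {x}"
  shows "twisted_wt e l r \<sigma> u lam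
      = twisted_wt e l r \<sigma> u mu - delta e l r (int (Suc k mod e)) mu - 1"
    and "delta e l r (int (Suc k mod e)) lam = delta e l r (int (Suc k mod e)) mu + 2"
proof -
  obtain a b j where abj: "x = (a, b, j)"
    by (cases x) auto
  have "(a, b, j) \<in> young l lam"
    using x unfolding abj removable_def by blast
  note node = young_Diff_node[OF lam mu this y[unfolded abj]]
  define v where "v = (\<lambda>j. r (\<sigma> j) + int e * u j)"
  define Bs where "Bs = (\<lambda>\<nu> :: nat \<Rightarrow> nat \<Rightarrow> nat. \<lambda>j. beta (v j) (\<nu> (\<sigma> j)))"
  have wt: "twisted_wt e l r \<sigma> u \<nu> = wt_beta e (uglov e l (Bs \<nu>))" for \<nu>
    by (simp add: twisted_wt_def wt_multi_def v_def Bs_def)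
  have delta: "delta e l r (int (Suc k mod e)) \<nu> = (\<Sum>j=1..l. gap_delta e k (Bs \<nu> j))"
    if "\<nu> \<in> multipartitions l" for \<nu>
    unfolding delta_eq_gap_delta[OF that k] Bs_def v_def beta_translate gap_delta_translate
    by (subst sum.permute[OF perm]) (simp add: comp_def)
  \<comment> \<open>The twist places component \<open>j\<close> at the index that
    \<open>\<sigma>\<close> maps to \<open>j\<close>, so the bead moves there.\<close>
  define m where "m = Hilbert_Choice.inv \<sigma> j"
  have m: "\<sigma> m = j" "m \<in> {1..l}"
    using permutes_inverses(1)[OF perm] permutes_in_image[OF perm, of m] node(2)
    by (simp_all add: m_def)
  \<comment> \<open>Taken with the twisted charge, \<open>z\<close> differs from the untwisted
    position by \<open>e * u m\<close> and so has the same residue.\<close>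
  define z where "z = int b - int a + v m - 1"
  have "(int b - int a + r j) mod int e = int (Suc k mod e)"
    using x removable_iff[OF lam] unfolding abj by blast
  then have "(int b - int a + r j - 1) mod int e = int k"
    using mod_succ_eq_iff[OF k, of "int b - int a + r j - 1"] by simp
  moreover have "z = int b - int a + r j - 1 + int e * u m"
    by (simp add: z_def v_def m)
  ultimately have z: "z mod int e = int k"
    by simp
  have bead: "Bs lam m = insert (z + 1) (Bs mu m - {z})" "z \<in> Bs mu m" "z + 1 \<notin> Bs mu m"
    unfolding Bs_def m(1)
    by (rule beta_remove_node[OF multipartition_component[OF lam node(2)]
          multipartition_component[OF mu node(2)] node(1)]; use node z_def in simp)+
  have other: "Bs lam c = Bs mu c" if "c \<in> {1..l}" "c \<noteq> m" for c
  proof -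
    have "\<sigma> c \<noteq> j"
      using that(2) permutes_inj[OF perm] m(1) by (auto dest: injD)
    then show ?thesis
      by (simp add: Bs_def node(5))
  qed
  have beta: "beta_set (Bs mu c)" if "c \<in> {1..l}" for c
    unfolding Bs_def by (rule beta_set_twisted[OF mu perm that])
  show "twisted_wt e l r \<sigma> u lam
      = twisted_wt e l r \<sigma> u mu - delta e l r (int (Suc k mod e)) mu - 1"
    unfolding wt delta[OF mu] using move_bead(1)[where Bs = "Bs mu" and Bs' = "Bs lam", OF e l k beta m(2) z bead(2,3,1) other] .
  show "delta e l r (int (Suc k mod e)) lam = delta e l r (int (Suc k mod e)) mu + 2"
    unfolding delta[OF mu] delta[OF lam] using move_bead(2)[where Bs = "Bs mu" and Bs' = "Bs lam", OF e l k beta m(2) z bead(2,3,1) other] .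
qed

section \<open>The sign of \<open>delta\<close> and Scopes equivalence\<close>

lemma addable_or_removable_empty:
  assumes e: "2 \<le> e" and l: "1 \<le> l" and i: "i \<in> {0..<int e}" and lam: "lam \<in> multipartitions l"
    and le: "wt_hecke e l r lam \<le> \<bar>delta e l r i lam\<bar>"
  shows "0 \<le> delta e l r i lam \<Longrightarrow> addable e l r i lam = {}"
    and "delta e l r i lam \<le> 0 \<Longrightarrow> removable e l r i lam = {}"
proof -
  \<comment> \<open>The cyclic predecessor of \<open>i\<close>; in particular \<open>i = 0\<close>
    gives \<open>k = e - 1\<close>.\<close>
  define k where "k = nat ((i - 1) mod int e)"
  have k: "k < e" "int k = (i - 1) mod int e"
    using e by (simp_all add: k_def nat_less_iff)
  have i_eq: "i = int (Suc k mod e)"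
    using mod_succ_eq_iff[OF k(1), of "i - 1"] k(2) i by simp
  obtain \<sigma> u where perm: "\<sigma> permutes {1..l}"
    and wt: "wt_hecke e l r lam = twisted_wt e l r \<sigma> u lam"
    using wt_hecke_attained[OF _ _ lam] e l by (metis One_nat_def Suc_le_eq less_le_trans pos2)
  have nonneg: "0 \<le> twisted_wt e l r \<sigma> u \<nu>" if "\<nu> \<in> multipartitions l" for \<nu>
    using e l by (intro twisted_wt_nonneg that perm) auto
  show "addable e l r i lam = {}" if "0 \<le> delta e l r i lam"
  proof (rule ccontr)
    assume "addable e l r i lam \<noteq> {}"
    then obtain x \<nu> where \<nu>: "\<nu> \<in> multipartitions l" "x \<in> removable e l r i \<nu>"
      "young l lam = young l \<nu> - {x}"
      by (auto simp: addable_def)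
    note change = twisted_wt_remove_node(1)[OF e l k(1) perm \<nu>(1) lam \<nu>(2)[unfolded i_eq] \<nu>(3),
        folded i_eq]
    show False
      using nonneg[OF \<nu>(1)] change[of u] that le wt by linarith
  qed
  show "removable e l r i lam = {}" if "delta e l r i lam \<le> 0"
  proof (rule ccontr)
    assume "removable e l r i lam \<noteq> {}"
    then obtain x where x: "x \<in> removable e l r i lam"
      by blast
    then obtain \<nu> where \<nu>: "\<nu> \<in> multipartitions l" "young l \<nu> = young l lam - {x}"
      unfolding removable_def by blast
    note change = twisted_wt_remove_node[OF e l k(1) perm lam \<nu>(1) x[unfolded i_eq] \<nu>(2),
        folded i_eq]
    \<comment> \<open>Here \<open>\<nu>\<close> is the smaller multipartition: its
      \<open>delta\<close> is that of \<open>lam\<close> minus 2, so its twisted weight is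
      \<open>wt_hecke e l r lam + delta e l r i lam - 1\<close>, which is negative.\<close>
    show False
      using nonneg[OF \<nu>(1)] change(1)[of u] change(2) that le wt by linarith
  qed
qed

theorem theorem4p11:
  fixes e l n n' :: nat
    and q :: "'f::field"
    and r :: "nat \<Rightarrow> int"
    and B C :: "'f ak set"
    and w k :: int
  assumes "2 \<le> e" and "1 \<le> l"
    and "primitive_root e q"
    and "B \<in> ring_blocks (AK l q r n)"
    and "C \<in> ring_blocks (AK l q r n')"
    and "wk_pair e l q r w k (n, B) (n', C)"
    and "w \<le> k"
  shows "scopes_equivalent e l q r (n, B) (n', C)"
proof -
  \<comment> \<open>Stated for arbitrary \<open>P\<close> and \<open>Q\<close> because a pair is
    unordered: the weight and \<open>delta\<close> may be given for either block.\<close>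
  have step: "scopes_step e l q r P Q"
    if i: "i \<in> {0..<int e}" and refl: "block_refl e l q r i P Q"
      and wt: "block_wt e l q r P w" and delta: "block_delta e l q r i P d" and k: "k = \<bar>d\<bar>"
    for i d and P Q :: "'f ak_block"
  proof -
    have mp: "lam \<in> multipartitions l"
      and wd: "wt_hecke e l r lam = w" "delta e l r i lam = d"
      and le: "wt_hecke e l r lam \<le> \<bar>delta e l r i lam\<bar>"
      if lam: "lam \<in> lying_in l q r P" for lam
    proof -
      show "lam \<in> multipartitions l"
        using lam by (auto simp: lying_in_def multipartitions_of_def)
      show "wt_hecke e l r lam = w" "delta e l r i lam = d"
        using lam wt delta unfolding block_wt_def block_delta_def by blast+
      then show "wt_hecke e l r lam \<le> \<bar>delta e l r i lam\<bar>"
        using k \<open>w \<le> k\<close> by simp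
    qed
    note empty = addable_or_removable_empty[OF assms(1,2) i mp le]
    \<comment> \<open>The sign of \<open>d\<close> is common to the whole block, so the same
      alternative holds for all its multipartitions at once.\<close>
    have "(\<forall>lam\<in>lying_in l q r P. addable e l r i lam = {})
        \<or> (\<forall>lam\<in>lying_in l q r P. removable e l r i lam = {})"
      using empty wd(2) by (cases "0 \<le> d") auto
    then show ?thesis
      using i refl unfolding scopes_step_def by blast
  qed
  have "symclp (scopes_step e l q r) (n, B) (n', C)"
    using assms(6) step unfolding wk_pair_def symclp_def by blast
  then show ?thesis
    unfolding scopes_equivalent_def symclp_def
    by (auto intro: r_into_equivclp equivclp_sym)
qed

end
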